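(* Let $\Gamma$ be an infinite, finitely generated amenable group with a finite symmetric generating set $S$, let $N$ be the spectral distribution of the Laplace operator of the uniform probability measure on $S$, and let $\mathrm{F\o l}$ be Følner's function of $\Gamma$ with respect to $S$. Let $F:(x_0,\infty)\to(0,\infty)$ be a continuous, strictly increasing function such that (1) $F(r)\to\infty$ as $r\to\infty$, (2) there is $C>1$ such that $F(r)^2\le F(Cr)$ for large $r>0$, (3) $F(r)\preceq\mathrm{F\o l}(r)$ near infinity. Then, near zero and in the dilatational sense, $$N(\lambda)\preceq\frac{1}{F\bigl(\lambda^{-1/2}\bigr)}.$$
   Context: Spectral distribution: for the uniform probability measure $\mu=\frac1{|S|}\sum_{s\in S}\delta_s$, let $R_\mu:l^2(\Gamma)\to l^2(\Gamma)$, $R_\mu(f)(x)=\sum_{\gamma}f(x\gamma^{-1})\mu(\gamma)$, and $\Delta=\mathrm{id}-R_\mu$. Then $N(\lambda)=\langle\chi_{(-\infty,\lambda]}(\Delta)\delta_e,\delta_e\rangle_{l^2(\Gamma)}$ for $\lambda\ge0$. Følner's function: $\mathrm{F\o l}:(0,\infty)\to\mathbb N$, $\mathrm{F\o l}(r)=\min\{|\Omega|:\ \Omega\subset\Gamma \text{ finite non-empty},\ |\partial_S\Omega|/|\Omega|<1/r\}$, where $\partial_S\Omega=\{x\in\Omega:\ \exists s\in S,\ xs\in\Gamma\setminus\Omega\}$. Asymptotic comparison: $f\preceq g$ near infinity means there are $C,D,x_1>0$ with $f(x)\le Cg(Dx)$ for all $x\ge x_1$. $f\preceq g$ near zero in the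 dilatational sense means there are $D,\epsilon>0$ with $f(\lambda)\le g(D\lambda)$ for all $\lambda\in[0,\epsilon)$; an expression defined only for small $\lambda>0$ (such as $1/F(\lambda^{-1/2})$) is given the value $0$ at $\lambda=0$. *)

theory Defs
  imports "HOL-Analysis.Analysis" "HOL-Algebra.Generated_Groups"
begin

subsection \<open>The Hilbert space of square-summable functions on a set\<close>

text \<open>Elements are total functions that vanish off the index set, so that equality of elements
  is equality of functions.\<close>

definition l2 :: "'a set \<Rightarrow> ('a \<Rightarrow> complex) set" where
  "l2 X = {f. (\<forall>x. x \<notin> X \<longrightarrow> f x = 0) \<and> (\<lambda>x. (cmod (f x))\<^sup>2) summable_on X}"

definition l2_inner :: "'a set \<Rightarrow> ('a \<Rightarrow> complex) \<Rightarrow> ('a \<Rightarrow> complex) \<Rightarrow> complex" where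
  "l2_inner X f g = (\<Sum>\<^sub>\<infinity>x\<in>X. f x * cnj (g x))"

definition l2_norm :: "'a set \<Rightarrow> ('a \<Rightarrow> complex) \<Rightarrow> real" where
  "l2_norm X f = sqrt (\<Sum>\<^sub>\<infinity>x\<in>X. (cmod (f x))\<^sup>2)"

definition l2_delta :: "'a \<Rightarrow> 'a \<Rightarrow> complex" where
  "l2_delta y = (\<lambda>x. if x = y then 1 else 0)"

definition l2_bounded_operator ::
    "'a set \<Rightarrow> (('a \<Rightarrow> complex) \<Rightarrow> ('a \<Rightarrow> complex)) \<Rightarrow> bool" where
  "l2_bounded_operator X T \<longleftrightarrow>
     T \<in> l2 X \<rightarrow>\<^sub>E l2 X \<and>
     (\<forall>f\<in>l2 X. \<forall>g\<in>l2 X. T (\<lambda>x. f x + g x) = (\<lambda>x. T f x + T g x)) \<and>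
     (\<forall>c. \<forall>f\<in>l2 X. T (\<lambda>x. c * f x) = (\<lambda>x. c * T f x)) \<and>
     (\<exists>M. \<forall>f\<in>l2 X. l2_norm X (T f) \<le> M * l2_norm X f)"

subsection \<open>Borel functional calculus of a bounded self-adjoint operator\<close>

text \<open>For a bounded self-adjoint operator \<open>A\<close> and a vector \<open>f\<close>, the spectral measure \<open>\<mu>\<^sub>f\<close> is
  the compactly supported finite Borel measure on the line with
  \<open>\<langle>p(A) f, f\<rangle> = \<integral> p d\<mu>\<^sub>f\<close> for all polynomials \<open>p\<close> (equivalently, by density, for all
  continuous \<open>p\<close>); by linearity it suffices to ask this for monomials. For a bounded Borel
  function \<open>h\<close>, the operator \<open>h(A)\<close> is then the bounded operator with
  \<open>\<langle>h(A) f, f\<rangle> = \<integral> h d\<mu>\<^sub>f\<close> for all \<open>f\<close>. It is unique since the scalars are complex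
  (polarization). For \<open>A\<close> not bounded self-adjoint, or \<open>h\<close> not bounded Borel, the definitions
  below carry no meaning.\<close>

definition l2_spectral_measure ::
    "'a set \<Rightarrow> (('a \<Rightarrow> complex) \<Rightarrow> ('a \<Rightarrow> complex)) \<Rightarrow> ('a \<Rightarrow> complex) \<Rightarrow> real measure" where
  "l2_spectral_measure X A f =
     (THE \<mu>. sets \<mu> = sets borel \<and> finite_measure \<mu> \<and> (\<exists>r. AE x in \<mu>. \<bar>x\<bar> \<le> r) \<and>
        (\<forall>n. l2_inner X ((A ^^ n) f) f = complex_of_real (\<integral>x. x ^ n \<partial>\<mu>)))"

definition l2_functional_calculus ::
    "'a set \<Rightarrow> (('a \<Rightarrow> complex) \<Rightarrow> ('a \<Rightarrow> complex)) \<Rightarrow> (real \<Rightarrow> complex) \<Rightarrow>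
     ('a \<Rightarrow> complex) \<Rightarrow> ('a \<Rightarrow> complex)" where
  "l2_functional_calculus X A h =
     (THE T. l2_bounded_operator X T \<and>
        (\<forall>f\<in>l2 X. l2_inner X (T f) f = (\<integral>x. h x \<partial>l2_spectral_measure X A f)))"

subsection \<open>Laplace operator and spectral distribution\<close>

definition uniform_weight :: "'a set \<Rightarrow> 'a \<Rightarrow> real" where
  "uniform_weight S \<gamma> = 1 / real (card S) * (\<Sum>s\<in>S. if \<gamma> = s then 1 else 0)"

definition right_convolution ::
    "('a, 'b) monoid_scheme \<Rightarrow> ('a \<Rightarrow> real) \<Rightarrow> ('a \<Rightarrow> complex) \<Rightarrow> ('a \<Rightarrow> complex)" where
  "right_convolution G \<mu> f =
     (\<lambda>x. if x \<in> carrier G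
          then \<Sum>\<^sub>\<infinity>\<gamma>\<in>carrier G. f (x \<otimes>\<^bsub>G\<^esub> inv\<^bsub>G\<^esub> \<gamma>) * complex_of_real (\<mu> \<gamma>)
          else 0)"

definition laplace_operator ::
    "('a, 'b) monoid_scheme \<Rightarrow> ('a \<Rightarrow> real) \<Rightarrow> ('a \<Rightarrow> complex) \<Rightarrow> ('a \<Rightarrow> complex)" where
  "laplace_operator G \<mu> f = (\<lambda>x. f x - right_convolution G \<mu> f x)"

text \<open>The inner product below is real because \<open>\<chi>\<^bsub>(-\<infinity>,\<lambda>]\<^esub>(\<Delta>)\<close> is self-adjoint.\<close>

definition spectral_distribution ::
    "('a, 'b) monoid_scheme \<Rightarrow> ('a \<Rightarrow> real) \<Rightarrow> real \<Rightarrow> real" where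
  "spectral_distribution G \<mu> lam =
     Re (l2_inner (carrier G)
           (l2_functional_calculus (carrier G) (laplace_operator G \<mu>) (indicator {..lam})
              (l2_delta \<one>\<^bsub>G\<^esub>))
           (l2_delta \<one>\<^bsub>G\<^esub>))"

subsection \<open>Amenability and the Folner function\<close>

definition amenable :: "('a, 'b) monoid_scheme \<Rightarrow> bool" where
  "amenable G \<longleftrightarrow>
     (\<exists>m :: 'a set \<Rightarrow> real.
        (\<forall>A. A \<subseteq> carrier G \<longrightarrow> 0 \<le> m A) \<and> m (carrier G) = 1 \<and>
        (\<forall>A B. A \<subseteq> carrier G \<longrightarrow> B \<subseteq> carrier G \<longrightarrow> A \<inter> B = {} \<longrightarrow> m (A \<union> B) = m A + m B) \<and>
        (\<forall>g\<in>carrier G. \<forall>A. A \<subseteq> carrier G \<longrightarrow> m (g <#\<^bsub>G\<^esub> A) = m A))"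

definition inner_boundary :: "('a, 'b) monoid_scheme \<Rightarrow> 'a set \<Rightarrow> 'a set \<Rightarrow> 'a set" where
  "inner_boundary G S \<Omega> = {x \<in> \<Omega>. \<exists>s\<in>S. x \<otimes>\<^bsub>G\<^esub> s \<in> carrier G - \<Omega>}"

definition folner :: "('a, 'b) monoid_scheme \<Rightarrow> 'a set \<Rightarrow> real \<Rightarrow> nat" where
  "folner G S r =
     (LEAST n. \<exists>\<Omega>. \<Omega> \<subseteq> carrier G \<and> finite \<Omega> \<and> \<Omega> \<noteq> {} \<and>
        real (card (inner_boundary G S \<Omega>)) / real (card \<Omega>) < 1 / r \<and> n = card \<Omega>)"

subsection \<open>Asymptotic comparison\<close>

text \<open>Functions defined only near infinity, or only near zero, are represented by total functions;
  values off the domain are irrelevant, because \<open>x\<^sub>1\<close> may be enlarged and \<open>\<epsilon>\<close> shrunk.\<close>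

definition preceq_at_infinity :: "(real \<Rightarrow> real) \<Rightarrow> (real \<Rightarrow> real) \<Rightarrow> bool" where
  "preceq_at_infinity f g \<longleftrightarrow>
     (\<exists>C>0. \<exists>D>0. \<exists>x\<^sub>1>0. \<forall>x\<ge>x\<^sub>1. f x \<le> C * g (D * x))"

definition dil_preceq_at_zero :: "(real \<Rightarrow> real) \<Rightarrow> (real \<Rightarrow> real) \<Rightarrow> bool" where
  "dil_preceq_at_zero f g \<longleftrightarrow>
     (\<exists>D>0. \<exists>\<epsilon>>0. \<forall>lam\<in>{0..<\<epsilon>}. f lam \<le> g (D * lam))"

end

theory Submission
  imports Defs "HOL-Probability.Helly_Selection" "HOL-Real_Asymp.Real_Asymp"
begin

text \<open>Let \<open>Q = 1 - \<Delta>/2\<close> be the lazy walk operator and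
  \<open>u\<^sub>n = \<parallel>Q\<^sup>n \<delta>\<^sub>e\<parallel>\<^sup>2 = \<integral> (1 - x/2)\<^bsup>2n\<^esup> d\<mu>\<close>, where \<open>\<mu>\<close> is the spectral measure of \<open>\<delta>\<^sub>e\<close>; hence
  \<open>(1 - \<lambda>/2)\<^bsup>2n\<^esup> N(\<lambda>) \<le> u\<^sub>n\<close>. Since \<open>Q\<close> contracts the \<open>\<ell>\<^sup>1\<close> norm, lowering \<open>|Q\<^sup>n \<delta>\<^sub>e|\<close> by
  \<open>u\<^sub>n/4\<close> keeps half of the square mass on a set with at most \<open>4/u\<^sub>n\<close> elements. As long as
  \<open>4/u\<^sub>n < Fol(r)\<close>, Cheeger's inequality on that set gives \<open>u\<^bsub>n+1\<^esub> \<le> (1 - \<kappa>) u\<^sub>n\<close> with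
  \<open>\<kappa> = 1 / (32 r\<^sup>2 |S|\<^sup>2)\<close>. Choosing \<open>r\<close> with \<open>\<kappa> = 4\<lambda>\<close> and \<open>n\<close> minimal with
  \<open>exp(-\<kappa>n) \<le> 4/Fol(r)\<close> yields \<open>N(\<lambda>) \<le> 2 e\<^sup>2 Fol(r)\<^bsup>-1/2\<^esup>\<close>, and condition (2) on \<open>F\<close> absorbs the
  square root and the constants into a dilation.

  The spectral measure is a weak limit of discrete measures with binomial weights (Hausdorff's
  moment problem) and is unique by the Weierstrass theorem; the spectral projection is a strong
  limit of polynomials in \<open>\<Delta>\<close>.\<close>

subsection \<open>Moments of measures with bounded support\<close>

lemma bounded_poly_on_interval: "\<exists>B. \<forall>x. \<bar>x\<bar> \<le> c \<longrightarrow> \<bar>poly p x\<bar> \<le> B" for c :: real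
proof -
  have "bounded (poly p ` {-c..c})"
    by (intro compact_imp_bounded compact_continuous_image continuous_intros compact_Icc)
  then show ?thesis unfolding bounded_iff by (force simp: abs_le_iff)
qed

lemma polynomial_approx_on_interval:
  fixes g :: "real \<Rightarrow> real"
  assumes "continuous_on {-c..c} g" and "0 < e"
  shows "\<exists>p :: real poly. \<forall>x. \<bar>x\<bar> \<le> c \<longrightarrow> \<bar>g x - poly p x\<bar> < e"
proof -
  obtain q where q: "real_polynomial_function q" "\<And>x. x \<in> {-c..c} \<Longrightarrow> \<bar>g x - q x\<bar> < e"
    using Stone_Weierstrass_real_polynomial_function[OF compact_Icc assms] by blast
  from q(1) obtain a n where "q = (\<lambda>x. \<Sum>i\<le>n. a i * x ^ i)"
    unfolding real_polynomial_function_iff_sum by blast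
  then have "q x = poly (\<Sum>i\<le>n. monom (a i) i) x" for x
    by (simp add: poly_sum poly_monom)
  with q(2) show ?thesis by (metis abs_le_iff atLeastAtMost_iff minus_le_iff)
qed

definition bounded_poly_limit :: "real \<Rightarrow> (nat \<Rightarrow> real poly) \<Rightarrow> (real \<Rightarrow> real) \<Rightarrow> bool" where
  "bounded_poly_limit c p h \<longleftrightarrow> (\<exists>B. \<forall>n x. \<bar>x\<bar> \<le> c \<longrightarrow> \<bar>poly (p n) x\<bar> \<le> B) \<and>
     (\<forall>x. \<bar>x\<bar> \<le> c \<longrightarrow> (\<lambda>n. poly (p n) x) \<longlonglongrightarrow> h x)"

lemma bounded_poly_limitE:
  assumes "bounded_poly_limit c p h"
  obtains B where "\<And>n x. \<bar>x\<bar> \<le> c \<Longrightarrow> \<bar>poly (p n) x\<bar> \<le> B" and "\<And>x. \<bar>x\<bar> \<le> c \<Longrightarrow> \<bar>h x\<bar> \<le> B"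
    and "\<And>x. \<bar>x\<bar> \<le> c \<Longrightarrow> (\<lambda>n. poly (p n) x) \<longlonglongrightarrow> h x"
proof -
  obtain B where B: "\<And>n x. \<bar>x\<bar> \<le> c \<Longrightarrow> \<bar>poly (p n) x\<bar> \<le> B"
    and lim: "\<And>x. \<bar>x\<bar> \<le> c \<Longrightarrow> (\<lambda>n. poly (p n) x) \<longlonglongrightarrow> h x"
    using assms unfolding bounded_poly_limit_def by blast
  have "\<bar>h x\<bar> \<le> B" if "\<bar>x\<bar> \<le> c" for x
    by (rule LIMSEQ_le_const2[OF tendsto_rabs[OF lim[OF that]]]) (use B[OF that] in blast)
  with B lim show ?thesis by (blast intro: that)
qed

lemma tendsto_indicator_atMost:
  fixes a x :: real
  shows "(\<lambda>n. min 1 (max 0 (1 - real n * (x - a)))) \<longlonglongrightarrow> indicator {..a} x"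
proof (cases "x \<le> a")
  case True
  then have "real n * (x - a) \<le> 0" for n by (simp add: mult_nonneg_nonpos)
  then have "min 1 (max 0 (1 - real n * (x - a))) = 1" for n by (smt (verit))
  with True show ?thesis by simp
next
  case False
  have "\<forall>\<^sub>F n in sequentially. min 1 (max 0 (1 - real n * (x - a))) = 0"
    using eventually_ge_at_top[of "nat \<lceil>1 / (x - a)\<rceil>"]
  proof eventually_elim
    case (elim n)
    then have "1 / (x - a) \<le> real n" by linarith
    with False show ?case by (simp add: field_simps)
  qed
  with False show ?thesis by (simp add: tendsto_eventually)
qed

lemma indicator_atMost_bounded_poly_limit:
  "\<exists>p. bounded_poly_limit c p (indicator {..a})"
proof -
  define g where "g n x = min 1 (max 0 (1 - real n * (x - a)))" for n x
  have "\<exists>p :: real poly. \<forall>x. \<bar>x\<bar> \<le> c \<longrightarrow> \<bar>g n x - poly p x\<bar> < 1 / real (Suc n)" for n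
    by (rule polynomial_approx_on_interval) (auto simp: g_def intro!: continuous_intros)
  then obtain p :: "nat \<Rightarrow> real poly"
    where p: "\<And>n x. \<bar>x\<bar> \<le> c \<Longrightarrow> \<bar>g n x - poly (p n) x\<bar> < 1 / real (Suc n)" by metis
  have "\<bar>poly (p n) x\<bar> \<le> 2" if "\<bar>x\<bar> \<le> c" for n x
  proof -
    have "\<bar>g n x\<bar> \<le> 1" "1 / real (Suc n) \<le> 1" by (simp_all add: g_def)
    with p[OF that, of n] show ?thesis by linarith
  qed
  moreover have "(\<lambda>n. poly (p n) x) \<longlonglongrightarrow> indicator {..a} x" if "\<bar>x\<bar> \<le> c" for x
  proof -
    have "(\<lambda>n. g n x - poly (p n) x) \<longlonglongrightarrow> 0"
      by (rule Lim_null_comparison[OF _ LIMSEQ_inverse_real_of_nat])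
         (use p[OF that] in \<open>simp add: less_imp_le inverse_eq_divide\<close>)
    from tendsto_diff[OF tendsto_indicator_atMost[of x a, folded g_def] this]
    show ?thesis by simp
  qed
  ultimately show ?thesis unfolding bounded_poly_limit_def by blast
qed

locale bounded_borel_measure = finite_borel_measure M for M :: "real measure" +
  fixes c :: real
  assumes AE_bounded: "AE x in M. \<bar>x\<bar> \<le> c"
begin

declare M_is_borel [measurable_cong]

lemma borel_measurable_poly [measurable]: "poly p \<in> borel_measurable M"
  by (subst measurable_cong_sets[OF M_is_borel refl])
     (intro borel_measurable_continuous_onI continuous_intros)

lemma integrable_poly: "integrable M (poly p)"
proof -
  obtain B where "\<And>x. \<bar>x\<bar> \<le> c \<Longrightarrow> \<bar>poly p x\<bar> \<le> B" using bounded_poly_on_interval by blast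
  then have "AE x in M. norm (poly p x) \<le> B" using AE_bounded by auto
  then show ?thesis by (rule integrable_const_bound) measurable
qed

lemma integrable_poly_square: "integrable M (\<lambda>x. (poly p x)\<^sup>2)"
  using integrable_poly[of "p\<^sup>2"] by (simp add: poly_power[abs_def])

lemma integral_poly_tendsto:
  assumes p: "bounded_poly_limit c p h" and [measurable]: "h \<in> borel_measurable borel"
  shows "(\<lambda>n. \<integral>x. poly (p n) x \<partial>M) \<longlonglongrightarrow> (\<integral>x. h x \<partial>M)"
proof -
  obtain B where B: "\<And>n x. \<bar>x\<bar> \<le> c \<Longrightarrow> \<bar>poly (p n) x\<bar> \<le> B"
    and lim: "\<And>x. \<bar>x\<bar> \<le> c \<Longrightarrow> (\<lambda>n. poly (p n) x) \<longlonglongrightarrow> h x"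
    using p by (rule bounded_poly_limitE) blast
  show ?thesis
  proof (rule integral_dominated_convergence[where w = "\<lambda>_. B"])
    show "AE x in M. (\<lambda>n. poly (p n) x) \<longlonglongrightarrow> h x" using AE_bounded lim by auto
    show "AE x in M. norm (poly (p n) x) \<le> B" for n using AE_bounded B by auto
  qed simp_all
qed

lemma
  assumes p: "bounded_poly_limit c p h" and [measurable]: "h \<in> borel_measurable borel"
  shows integrable_poly_diff_sq: "integrable M (\<lambda>x. (poly (p n) x - h x)\<^sup>2)"
    and integral_poly_diff_sq_tendsto: "(\<lambda>n. \<integral>x. (poly (p n) x - h x)\<^sup>2 \<partial>M) \<longlonglongrightarrow> 0"
proof -
  obtain B where B: "\<And>n x. \<bar>x\<bar> \<le> c \<Longrightarrow> \<bar>poly (p n) x\<bar> \<le> B" "\<And>x. \<bar>x\<bar> \<le> c \<Longrightarrow> \<bar>h x\<bar> \<le> B"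
    and lim: "\<And>x. \<bar>x\<bar> \<le> c \<Longrightarrow> (\<lambda>n. poly (p n) x) \<longlonglongrightarrow> h x"
    using p by (rule bounded_poly_limitE) blast
  have bound: "AE x in M. norm ((poly (p n) x - h x)\<^sup>2) \<le> (2 * B)\<^sup>2" for n
    using AE_bounded
  proof eventually_elim
    case (elim x)
    have "\<bar>poly (p n) x - h x\<bar> \<le> 2 * B" using B(1)[OF elim, of n] B(2)[OF elim] by linarith
    then have "\<bar>poly (p n) x - h x\<bar>\<^sup>2 \<le> (2 * B)\<^sup>2" by (rule power_mono) simp
    then show ?case by simp
  qed
  then show "integrable M (\<lambda>x. (poly (p n) x - h x)\<^sup>2)"
    by (rule integrable_const_bound) measurable
  have "(\<lambda>n. \<integral>x. (poly (p n) x - h x)\<^sup>2 \<partial>M) \<longlonglongrightarrow> (\<integral>x. 0 \<partial>M)"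
  proof (rule integral_dominated_convergence[OF _ _ _ _ bound])
    show "AE x in M. (\<lambda>n. (poly (p n) x - h x)\<^sup>2) \<longlonglongrightarrow> 0"
      using AE_bounded
    proof eventually_elim
      case (elim x)
      have "(\<lambda>n. (poly (p n) x - h x)\<^sup>2) \<longlonglongrightarrow> (h x - h x)\<^sup>2" by (intro tendsto_intros lim elim)
      then show ?case by simp
    qed
  qed simp_all
  then show "(\<lambda>n. \<integral>x. (poly (p n) x - h x)\<^sup>2 \<partial>M) \<longlonglongrightarrow> 0" by simp
qed

lemma measure_atMost_le_integral_poly_square:
  assumes "0 \<le> b" and "\<And>x. x \<le> a \<Longrightarrow> b \<le> (poly p x)\<^sup>2"
  shows "b * measure M {..a} \<le> (\<integral>x. (poly p x)\<^sup>2 \<partial>M)"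
proof -
  have "b * measure M {..a} = (\<integral>x. b * indicator {..a} x \<partial>M)"
    by (simp add: borel_UNIV)
  also have "\<dots> \<le> (\<integral>x. (poly p x)\<^sup>2 \<partial>M)"
  proof (rule integral_mono[OF _ integrable_poly_square])
    show "integrable M (\<lambda>x. b * indicator {..a} x)"
      by (intro integrable_mult_right integrable_real_indicator) (auto simp: emeasure_eq_measure)
  qed (use assms in \<open>auto simp: indicator_def\<close>)
  finally show ?thesis .
qed

end

locale real_poly_functional =
  fixes L :: "real poly \<Rightarrow> real"
  assumes add: "L (p + q) = L p + L q" and smult: "L (smult a p) = a * L p"
begin

lemma sum: "L (\<Sum>i\<in>I. p i) = (\<Sum>i\<in>I. L (p i))"
proof -
  have "L 0 = 0" using smult[of 0 0] by simp
  then show ?thesis by (induction I rule: infinite_finite_induct) (simp_all add: add)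
qed

lemma diff: "L (p - q) = L p - L q"
  using add[of "p - q" q] by simp

lemma of_nat_mult: "L (of_nat n * p) = real n * L p"
  using smult[of "real n" p] by (simp add: of_nat_poly)

lemma eq_sum_coeff: "L p = (\<Sum>i\<le>degree p. coeff p i * L (monom 1 i))"
proof -
  have "L p = L (\<Sum>i\<le>degree p. smult (coeff p i) (monom 1 i))"
    by (simp add: smult_monom poly_as_sum_of_monoms)
  then show ?thesis by (simp add: sum smult)
qed

end

lemma real_poly_functional_eqI:
  assumes "real_poly_functional L" and "real_poly_functional L'"
    and "\<And>n. L (monom 1 n) = L' (monom 1 n)"
  shows "L p = L' p"
  using assms by (simp add: real_poly_functional.eq_sum_coeff[of L p]
      real_poly_functional.eq_sum_coeff[of L' p])

lemma bounded_borel_measureI: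
  "finite_measure M \<Longrightarrow> sets M = sets borel \<Longrightarrow> AE x in M. \<bar>x\<bar> \<le> c \<Longrightarrow> bounded_borel_measure M c"
  by (simp add: bounded_borel_measure_def bounded_borel_measure_axioms_def
      finite_borel_measure_def finite_borel_measure_axioms_def)

lemma (in bounded_borel_measure) mono_bound: "c \<le> c' \<Longrightarrow> bounded_borel_measure M c'"
  using AE_bounded M_is_borel
  by (intro bounded_borel_measureI finite_measure_axioms) auto

lemma (in bounded_borel_measure) real_poly_functional_integral:
  "real_poly_functional (\<lambda>p. \<integral>x. poly p x \<partial>M)"
  by standard (simp_all add: integrable_poly)

lemma moments_determine_measure:
  assumes M: "bounded_borel_measure M c" and N: "bounded_borel_measure N c'"
    and moments: "\<And>n. (\<integral>x. x ^ n \<partial>M) = (\<integral>x. x ^ n \<partial>N)"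
  shows "M = N"
proof -
  interpret M: bounded_borel_measure M "max c c'"
    by (rule bounded_borel_measure.mono_bound[OF M]) simp
  interpret N: bounded_borel_measure N "max c c'"
    by (rule bounded_borel_measure.mono_bound[OF N]) simp
  have poly: "(\<integral>x. poly p x \<partial>M) = (\<integral>x. poly p x \<partial>N)" for p
    by (rule real_poly_functional_eqI[OF M.real_poly_functional_integral
          N.real_poly_functional_integral]) (simp add: poly_monom moments)
  have "measure M {..a} = measure N {..a}" for a
  proof -
    obtain p where p: "bounded_poly_limit (max c c') p (indicator {..a})"
      using indicator_atMost_bounded_poly_limit by blast
    have "(\<integral>x. indicator {..a} x \<partial>M) = (\<integral>x. indicator {..a} x \<partial>N :: real)"
      by (rule LIMSEQ_unique[OF M.integral_poly_tendsto[OF p]])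
         (use N.integral_poly_tendsto[OF p] in \<open>simp_all add: poly\<close>)
    then show ?thesis by (simp add: M.borel_UNIV N.borel_UNIV)
  qed
  then have "cdf M = cdf N" by (simp add: cdf_def fun_eq_iff)
  then show ?thesis
    by (rule cdf_unique'[OF M.finite_borel_measure_axioms N.finite_borel_measure_axioms])
qed

subsection \<open>The moment problem on a bounded interval\<close>

lemma weak_conv_AE_closed:
  assumes \<mu>: "\<And>n. real_distribution (\<mu> n)" and M: "real_distribution M"
    and weak: "weak_conv_m \<mu> M"
    and C: "closed C" "C \<noteq> {}" and AE: "\<And>n. AE x in \<mu> n. x \<in> C"
  shows "AE x in M. x \<in> C"
proof -
  interpret M: real_distribution M by (rule M)
  define d where "d x = min 1 (infdist x C)" for x
  have d_cont: "continuous_on UNIV d" unfolding d_def by (intro continuous_intros)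
  have d_bounds: "0 \<le> d x" "\<bar>d x\<bar> \<le> 1" for x by (simp_all add: d_def infdist_nonneg)
  have "(\<integral>x. d x \<partial>\<mu> n) = 0" for n
    by (rule integral_eq_zero_AE) (use AE[of n] in \<open>auto simp: d_def\<close>)
  moreover have "(\<lambda>n. \<integral>x. d x \<partial>\<mu> n) \<longlonglongrightarrow> (\<integral>x. d x \<partial>M)"
    using d_cont d_bounds
    by (intro weak_conv_imp_integral_bdd_continuous_conv[OF \<mu> M weak, of d 1])
       (auto simp: continuous_on_eq_continuous_at)
  ultimately have "(\<integral>x. d x \<partial>M) = 0" by (simp add: LIMSEQ_const_iff)
  moreover have [measurable]: "d \<in> borel_measurable borel"
    by (rule borel_measurable_continuous_onI[OF d_cont])
  then have "integrable M d"
    by (intro M.integrable_const_bound[of _ 1]) (use d_bounds in auto)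
  ultimately have "AE x in M. d x = 0"
    using d_bounds by (simp add: integral_nonneg_eq_0_iff_AE)
  then show ?thesis
    by eventually_elim
       (use C in \<open>auto simp: d_def in_closed_iff_infdist_zero min_def split: if_splits\<close>)
qed

lemma tight_if_AE_in_interval:
  assumes \<mu>: "\<And>n. real_distribution (\<mu> n)" and AE: "\<And>n. AE x in \<mu> n. x \<in> {a..b}"
  shows "tight \<mu>"
  unfolding tight_def
proof (intro conjI allI impI \<mu>)
  fix e :: real assume "0 < e"
  have "measure (\<mu> n) {a - 1<..max a b} = 1" for n
  proof -
    interpret real_distribution "\<mu> n" by (rule \<mu>)
    have "AE x in \<mu> n. x \<in> {a - 1<..max a b}" using AE[of n] by eventually_elim auto
    then show ?thesis by (simp add: prob_eq_1)
  qed
  with \<open>0 < e\<close> show "\<exists>u v. u < v \<and> (\<forall>n. 1 - e < measure (\<mu> n) {u<..v})"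
    by (intro exI[of _ "a - 1"] exI[of _ "max a b"]) auto
qed

lemma integral_ext_cont:
  assumes "real_distribution M" and AE: "AE x in M. x \<in> {a..b}"
    and g: "continuous_on UNIV (g :: real \<Rightarrow> real)"
  shows "(\<integral>x. ext_cont g a b x \<partial>M) = (\<integral>x. g x \<partial>M)"
proof -
  interpret real_distribution M by (rule assms(1))
  have [measurable]: "g \<in> borel_measurable borel" "ext_cont g a b \<in> borel_measurable borel"
    using g by (auto intro!: borel_measurable_continuous_onI continuous_on_ext_cont
        elim: continuous_on_subset)
  show ?thesis
    by (rule integral_cong_AE) (use AE in auto)
qed

lemma interval_distributions_convergent_subsequence:
  assumes \<mu>: "\<And>n. real_distribution (\<mu> n)" and AE: "\<And>n. AE x in \<mu> n. x \<in> {a..b}"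
  obtains s M where "strict_mono (s :: nat \<Rightarrow> nat)" and "real_distribution M"
    and "AE x in M. x \<in> {a..b}"
    and "\<And>g :: real \<Rightarrow> real. continuous_on UNIV g \<Longrightarrow> (\<lambda>n. \<integral>x. g x \<partial>\<mu> (s n)) \<longlonglongrightarrow> (\<integral>x. g x \<partial>M)"
proof -
  have "tight \<mu>" by (rule tight_if_AE_in_interval[OF assms])
  from tight_imp_convergent_subsubsequence[OF this strict_mono_id]
  obtain s M where s: "strict_mono (s :: nat \<Rightarrow> nat)" and M: "real_distribution M"
    and weak: "weak_conv_m (\<lambda>n. \<mu> (s n)) M"
    by (auto simp: comp_def id_def)
  have "{a..b} \<noteq> {}"
  proof
    assume "{a..b} = {}"
    with AE[of 0] have "AE x in \<mu> 0. False" by (simp only: empty_iff)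
    with \<mu>[of 0] show False by (simp add: real_distribution_def prob_space.AE_False)
  qed
  then have AE_M: "AE x in M. x \<in> {a..b}"
    by (intro weak_conv_AE_closed[OF \<mu> M weak _ _ AE]) simp_all
  have "(\<lambda>n. \<integral>x. g x \<partial>\<mu> (s n)) \<longlonglongrightarrow> (\<integral>x. g x \<partial>M)" if g: "continuous_on UNIV g" for g :: "real \<Rightarrow> real"
  proof -
    have g_ab: "continuous_on (cbox a b) g" using g by (rule continuous_on_subset) simp
    then have "bounded (range (ext_cont g a b))"
      unfolding ext_cont_def
      by (intro clamp_bounded compact_imp_bounded compact_continuous_image) auto
    then obtain B where "\<And>x. norm (ext_cont g a b x) \<le> B" by (auto simp: bounded_iff)
    moreover have "isCont (ext_cont g a b) x" for x
      unfolding ext_cont_def using g_ab by (rule clamp_continuous_at)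
    ultimately have "(\<lambda>n. \<integral>x. ext_cont g a b x \<partial>\<mu> (s n)) \<longlonglongrightarrow> (\<integral>x. ext_cont g a b x \<partial>M)"
      by (intro weak_conv_imp_integral_bdd_continuous_conv[OF \<mu> M weak])
    then show ?thesis by (simp only: integral_ext_cont[OF \<mu> AE g] integral_ext_cont[OF M AE_M g])
  qed
  with s M AE_M show ?thesis by (rule that)
qed

lemma choose_ratio_eq_prod:
  "real (k choose n) / real (N choose n) = (\<Prod>i<n. (real k - real i) / (real N - real i))"
proof -
  have "real (m choose n) = (\<Prod>i<n. real m - real i) / fact n" for m
    by (simp add: binomial_gbinomial gbinomial_prod_rev atLeast0LessThan)
  then show ?thesis by (simp add: prod_dividef)
qed

lemma shifted_ratio_diff:
  assumes "k \<le> N" and "n < N" and "i < n"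
  shows "\<bar>(real k - real i) / (real N - real i) - real k / real N\<bar> \<le> real n / (real N - real n)"
proof -
  have "(real k - real i) / (real N - real i) - real k / real N
      = - (real i * ((real N - real k) / real N) / (real N - real i))"
    using assms by (simp add: field_simps)
  also have "\<bar>\<dots>\<bar> = real i * ((real N - real k) / real N) / (real N - real i)"
    using assms by (simp add: abs_mult)
  also have "\<dots> \<le> real n / (real N - real n)"
  proof (rule frac_le)
    have "real i * ((real N - real k) / real N) \<le> real n * 1"
      using assms by (intro mult_mono) auto
    then show "real i * ((real N - real k) / real N) \<le> real n" by simp
  qed (use assms in auto)
  finally show ?thesis .
qed

lemma choose_ratio_power_diff:
  assumes "k \<le> N" and "2 * n < N"
  shows "\<bar>real (k choose n) / real (N choose n) - (real k / real N) ^ n\<bar>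
           \<le> real n * (real n / (real N - real n))"
proof -
  have factor_le_1: "\<bar>(real k - real i) / (real N - real i)\<bar> \<le> 1" if "i < n" for i
    using assms that by (simp add: abs_le_iff)
  have "\<bar>(\<Prod>i<n. (real k - real i) / (real N - real i)) - (\<Prod>i<n. real k / real N)\<bar>
      \<le> (\<Sum>i<n. \<bar>(real k - real i) / (real N - real i) - real k / real N\<bar>)"
    using norm_prod_diff[of "{..<n}" "\<lambda>i. (real k - real i) / (real N - real i)"
        "\<lambda>i. real k / real N"] factor_le_1 assms by simp
  also have "\<dots> \<le> (\<Sum>i<n. real n / (real N - real n))"
    using assms by (intro sum_mono shifted_ratio_diff) auto
  finally show ?thesis by (simp add: choose_ratio_eq_prod)
qed

lemma binomial_factorial_moment:
  fixes x y :: "'c::comm_ring_1"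
  assumes "n \<le> N"
  shows "(\<Sum>k\<le>N. of_nat ((k choose n) * (N choose k)) * (x ^ k * y ^ (N - k)))
           = of_nat (N choose n) * (x ^ n * (x + y) ^ (N - n))"
proof -
  have "(\<Sum>k\<le>N. of_nat ((k choose n) * (N choose k)) * (x ^ k * y ^ (N - k)))
      = (\<Sum>k\<in>{n..N}. of_nat ((k choose n) * (N choose k)) * (x ^ k * y ^ (N - k)))"
    by (rule sum.mono_neutral_right) (auto simp: binomial_eq_0)
  also have "\<dots> = (\<Sum>j\<le>N - n. of_nat (((j + n) choose n) * (N choose (j + n)))
                     * (x ^ (j + n) * y ^ (N - (j + n))))"
    by (rule sum.reindex_bij_witness[of _ "\<lambda>j. j + n" "\<lambda>k. k - n"]) (use assms in auto)
  also have "\<dots> = (\<Sum>j\<le>N - n. of_nat (N choose n) * (x ^ n *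
                     (of_nat ((N - n) choose j) * x ^ j * y ^ (N - n - j))))"
  proof (rule sum.cong[OF refl])
    fix j assume "j \<in> {..N - n}"
    then have "((j + n) choose n) * (N choose (j + n)) = (N choose n) * ((N - n) choose j)"
      using choose_mult[of n "j + n" N] assms by (simp add: mult.commute)
    then show "of_nat (((j + n) choose n) * (N choose (j + n))) * (x ^ (j + n) * y ^ (N - (j + n)))
        = of_nat (N choose n) * (x ^ n * (of_nat ((N - n) choose j) * x ^ j * y ^ (N - n - j)))"
      by (simp add: power_add mult_ac diff_diff_add add.commute)
  qed
  also have "\<dots> = of_nat (N choose n) * (x ^ n * (x + y) ^ (N - n))"
    by (simp add: binomial_ring sum_distrib_left)
  finally show ?thesis .
qed

locale hausdorff_functional = real_poly_functional +
  assumes Bernstein_nonneg: "0 \<le> L ([:0, 1:] ^ k * [:1, -1:] ^ l)" and one: "L 1 = 1"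
begin

definition weight :: "nat \<Rightarrow> nat \<Rightarrow> real" where
  "weight N k = real (N choose k) * L ([:0, 1:] ^ k * [:1, -1:] ^ (N - k))"

lemma weight_nonneg: "0 \<le> weight N k"
  by (simp add: weight_def Bernstein_nonneg)

lemma weight_factorial_moment:
  assumes "n \<le> N"
  shows "(\<Sum>k\<le>N. real (k choose n) * weight N k) = real (N choose n) * L (monom 1 n)"
proof -
  have "real (k choose n) * weight N k
      = L (of_nat ((k choose n) * (N choose k)) * ([:0, 1:] ^ k * [:1, -1:] ^ (N - k)))" for k
    unfolding of_nat_mult weight_def by simp
  then have "(\<Sum>k\<le>N. real (k choose n) * weight N k)
      = L (of_nat (N choose n) * ([:0, 1:] ^ n * ([:0, 1:] + [:1, -1:]) ^ (N - n)))"
    by (simp only: sum[symmetric] binomial_factorial_moment[OF assms])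
  also have "[:0, 1:] + [:1, -1:] = (1 :: real poly)" by (simp add: one_pCons)
  finally show ?thesis by (simp only: of_nat_mult power_one mult_1_right monom_altdef smult_1_left)
qed

lemma sum_weight: "(\<Sum>k\<le>N. weight N k) = 1"
  using weight_factorial_moment[of 0 N] one by (simp add: monom_0 one_pCons)

definition binomial_measure :: "nat \<Rightarrow> real measure" where
  "binomial_measure N =
     distr (point_measure {..N} (\<lambda>k. ennreal (weight N k))) borel (\<lambda>k. real k / real N)"

lemma real_distribution_binomial_measure: "real_distribution (binomial_measure N)"
proof -
  have "prob_space (point_measure {..N} (\<lambda>k. ennreal (weight N k)))"
    by (rule prob_spaceI)
       (simp add: space_point_measure emeasure_point_measure_finite sum_ennreal weight_nonneg
          sum_weight)
  then show ?thesis
    unfolding real_distribution_def real_distribution_axioms_def binomial_measure_def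
    by (auto intro: prob_space.prob_space_distr)
qed

lemma AE_binomial_measure: "AE x in binomial_measure N. x \<in> {0..1}"
  unfolding binomial_measure_def
  by (subst AE_distr_iff) (auto simp: AE_point_measure divide_le_eq_1)

lemma integral_binomial_measure:
  assumes "g \<in> borel_measurable borel"
  shows "(\<integral>x. g x \<partial>binomial_measure N) = (\<Sum>k\<le>N. weight N k * g (real k / real N))"
  unfolding binomial_measure_def using assms
  by (subst integral_distr) (auto simp: lebesgue_integral_point_measure_finite weight_nonneg)

lemma binomial_measure_moment_diff:
  assumes "2 * n < N"
  shows "\<bar>(\<integral>x. x ^ n \<partial>binomial_measure N) - L (monom 1 n)\<bar>
           \<le> real n * (real n / (real N - real n))"
proof -
  let ?\<delta> = "\<lambda>k. (real k / real N) ^ n - real (k choose n) / real (N choose n)"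
  have "L (monom 1 n) = (\<Sum>k\<le>N. weight N k * (real (k choose n) / real (N choose n)))"
    using weight_factorial_moment[of n N] assms
    by (simp add: sum_divide_distrib[symmetric] mult.commute)
  then have "\<bar>(\<integral>x. x ^ n \<partial>binomial_measure N) - L (monom 1 n)\<bar> = \<bar>\<Sum>k\<le>N. weight N k * ?\<delta> k\<bar>"
    by (simp add: integral_binomial_measure sum_subtractf right_diff_distrib)
  also have "\<dots> \<le> (\<Sum>k\<le>N. weight N k * \<bar>?\<delta> k\<bar>)"
    by (rule order_trans[OF sum_abs]) (simp add: abs_mult weight_nonneg)
  also have "\<dots> \<le> (\<Sum>k\<le>N. weight N k * (real n * (real n / (real N - real n))))"
    using choose_ratio_power_diff[of _ N n] assms
    by (intro sum_mono mult_left_mono) (auto simp: weight_nonneg abs_minus_commute)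
  also have "\<dots> = real n * (real n / (real N - real n))"
    by (simp only: sum_distrib_right[symmetric] sum_weight mult_1_left)
  finally show ?thesis .
qed

lemma binomial_measure_moment_tendsto:
  "(\<lambda>N. \<integral>x. x ^ n \<partial>binomial_measure N) \<longlonglongrightarrow> L (monom 1 n)"
proof (rule LIM_zero_cancel, rule Lim_null_comparison)
  show "(\<lambda>N. real n * (real n / (real N - real n))) \<longlonglongrightarrow> 0" by real_asymp
  show "\<forall>\<^sub>F N in sequentially. norm ((\<integral>x. x ^ n \<partial>binomial_measure N) - L (monom 1 n))
          \<le> real n * (real n / (real N - real n))"
    using eventually_gt_at_top[of "2 * n"]
    by eventually_elim (simp only: real_norm_def binomial_measure_moment_diff)
qed

lemma representing_distribution_exists:
  "\<exists>M. real_distribution M \<and> (AE x in M. x \<in> {0..1}) \<and> (\<forall>n. (\<integral>x. x ^ n \<partial>M) = L (monom 1 n))"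
proof -
  obtain s M where s: "strict_mono (s :: nat \<Rightarrow> nat)"
    and M: "real_distribution M" "AE x in M. x \<in> {0..1}"
    and lim: "\<And>g :: real \<Rightarrow> real. continuous_on UNIV g \<Longrightarrow>
      (\<lambda>N. \<integral>x. g x \<partial>binomial_measure (s N)) \<longlonglongrightarrow> (\<integral>x. g x \<partial>M)"
    by (rule interval_distributions_convergent_subsequence[OF real_distribution_binomial_measure
          AE_binomial_measure]) (rule that)
  have "(\<integral>x. x ^ n \<partial>M) = L (monom 1 n)" for n
  proof (rule LIMSEQ_unique)
    show "(\<lambda>N. \<integral>x. x ^ n \<partial>binomial_measure (s N)) \<longlonglongrightarrow> (\<integral>x. x ^ n \<partial>M)"
      by (intro lim continuous_intros)
    show "(\<lambda>N. \<integral>x. x ^ n \<partial>binomial_measure (s N)) \<longlonglongrightarrow> L (monom 1 n)"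
      using LIMSEQ_subseq_LIMSEQ[OF binomial_measure_moment_tendsto s] by (simp add: comp_def)
  qed
  with M show ?thesis by blast
qed

end

lemma pcompose_power: "pcompose (p ^ n) q = pcompose p q ^ n"
  by (induction n) (simp_all add: pcompose_1 pcompose_mult)

lemma
  fixes c m :: real
  assumes "real_distribution M" and AE: "AE x in M. x \<in> {0..1}" and c: "0 < c" and m: "0 < m"
  defines "\<mu> \<equiv> distr (density M (\<lambda>_. ennreal m)) borel (\<lambda>x. c * x)"
  shows bounded_borel_measure_rescaled: "bounded_borel_measure \<mu> c"
    and moment_rescaled: "(\<integral>x. x ^ n \<partial>\<mu>) = m * c ^ n * (\<integral>x. x ^ n \<partial>M)"
proof -
  interpret real_distribution M by (rule assms(1))
  have "finite_measure (density M (\<lambda>_. ennreal m))"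
    by (rule finite_measureI) (simp add: emeasure_density_const ennreal_mult_eq_top_iff)
  then have "finite_measure \<mu>"
    unfolding \<mu>_def by (rule finite_measure.finite_measure_distr) simp
  moreover have "AE x in \<mu>. \<bar>x\<bar> \<le> c"
  proof -
    have "AE x in M. \<bar>c * x\<bar> \<le> c"
      using AE by eventually_elim (use c in \<open>auto simp: abs_mult\<close>)
    then show ?thesis
      unfolding \<mu>_def by (subst AE_distr_iff) (auto simp: AE_density elim!: eventually_mono)
  qed
  ultimately show "bounded_borel_measure \<mu> c"
    by (intro bounded_borel_measureI) (simp_all add: \<mu>_def)
  show "(\<integral>x. x ^ n \<partial>\<mu>) = m * c ^ n * (\<integral>x. x ^ n \<partial>M)"
    unfolding \<mu>_def using m
    by (subst integral_distr) (simp_all add: integral_density power_mult_distrib)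
qed

locale interval_positive_functional = real_poly_functional +
  fixes c :: real
  assumes c_pos: "0 < c" and nonneg: "0 \<le> L ([:0, 1:] ^ k * [:c, -1:] ^ l)"
begin

lemma monom_eq_0:
  assumes "L 1 = 0"
  shows "L (monom 1 n) = 0"
proof (induction n)
  case 0
  with assms show ?case by (simp add: monom_0 one_pCons)
next
  case (Suc n)
  have "[:0, 1:] ^ n * [:c, -1:] ^ 1 = smult c (monom 1 n) - monom 1 (Suc n)"
    by (simp add: monom_altdef)
  with nonneg[of n 1] have "L (monom 1 (Suc n)) \<le> c * L (monom 1 n)"
    by (simp only: diff smult)
  moreover have "0 \<le> L (monom 1 (Suc n))"
    using nonneg[of "Suc n" 0] by (simp add: monom_altdef)
  ultimately show ?case using Suc by simp
qed

lemma hausdorff_functional_rescaled: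
  assumes "L 1 \<noteq> 0"
  shows "hausdorff_functional (\<lambda>p. L (pcompose p [:0, 1/c:]) / L 1)"
proof
  show "L (pcompose (p + q) [:0, 1/c:]) / L 1
      = L (pcompose p [:0, 1/c:]) / L 1 + L (pcompose q [:0, 1/c:]) / L 1" for p q
    by (simp add: pcompose_add add add_divide_distrib)
  show "L (pcompose (smult a p) [:0, 1/c:]) / L 1 = a * (L (pcompose p [:0, 1/c:]) / L 1)" for a p
    by (simp add: pcompose_smult smult)
  show "L (pcompose 1 [:0, 1/c:]) / L 1 = 1" using assms by (simp add: pcompose_1)
  show "0 \<le> L (pcompose ([:0, 1:] ^ k * [:1, -1:] ^ l) [:0, 1/c:]) / L 1" for k l
  proof -
    have "pcompose [:0, 1:] [:0, 1/c:] = smult (1/c) [:0, 1:]"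
      "pcompose [:1, -1:] [:0, 1/c:] = smult (1/c) [:c, -1:]"
      using c_pos by (simp_all add: pcompose_pCons)
    then have "pcompose ([:0, 1:] ^ k * [:1, -1:] ^ l) [:0, 1/c:]
        = smult ((1/c) ^ l * (1/c) ^ k) ([:0, 1:] ^ k * [:c, -1:] ^ l)"
      by (simp only: pcompose_mult pcompose_power smult_power mult_smult_left mult_smult_right
          smult_smult)
    moreover have "0 \<le> L 1" using nonneg[of 0 0] by simp
    ultimately show ?thesis
      using nonneg[of k l] c_pos by (simp add: smult)
  qed
qed

lemma representing_measure_exists:
  "\<exists>M. bounded_borel_measure M c \<and> (\<forall>n. (\<integral>x. x ^ n \<partial>M) = L (monom 1 n))"
proof (cases "L 1 = 0")
  case True
  have "finite_measure (null_measure borel)" by (rule finite_measureI) simp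
  moreover have "AE x in null_measure borel. \<bar>x\<bar> \<le> c" by (rule AE_I[of _ _ UNIV]) simp_all
  ultimately have "bounded_borel_measure (null_measure borel) c"
    by (intro bounded_borel_measureI) simp_all
  with monom_eq_0[OF True] show ?thesis
    by (intro exI[of _ "null_measure borel"]) simp
next
  case False
  then have mass: "0 < L 1" using nonneg[of 0 0] by simp
  obtain M where M: "real_distribution M" "AE x in M. x \<in> {0..1}"
    and moments: "\<And>n. (\<integral>x. x ^ n \<partial>M) = L (pcompose (monom 1 n) [:0, 1/c:]) / L 1"
    using hausdorff_functional.representing_distribution_exists[OF
        hausdorff_functional_rescaled[OF False]] by blast
  have "L 1 * c ^ n * (\<integral>x. x ^ n \<partial>M) = L (monom 1 n)" for n
  proof -
    have "pcompose (monom 1 n) [:0, 1/c:] = smult ((1/c) ^ n) (monom 1 n)"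
      using smult_power[of "1/c" "[:0, 1:]" n]
      by (simp add: monom_altdef pcompose_power pcompose_pCons)
    then show ?thesis using c_pos mass by (simp add: moments smult power_one_over)
  qed
  then show ?thesis
    using bounded_borel_measure_rescaled[OF M c_pos mass] moment_rescaled[OF M c_pos mass] by metis
qed

end

subsection \<open>The space of square-summable functions\<close>

lemma l2_outside: "f \<in> l2 X \<Longrightarrow> x \<notin> X \<Longrightarrow> f x = 0"
  by (simp add: l2_def)

lemma l2_norm_sq: "(l2_norm X f)\<^sup>2 = (\<Sum>\<^sub>\<infinity>x\<in>X. (cmod (f x))\<^sup>2)"
  by (simp add: l2_norm_def infsum_nonneg)

lemma l2_norm_nonneg [simp]: "0 \<le> l2_norm X f"
  by (simp add: l2_norm_def infsum_nonneg)

lemma L2_set_le_l2_norm: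
  assumes "f \<in> l2 X" and "finite A" and "A \<subseteq> X"
  shows "L2_set (\<lambda>x. cmod (f x)) A \<le> l2_norm X f"
  unfolding L2_set_def l2_norm_def using assms
  by (intro real_sqrt_le_mono finite_sum_le_infsum) (auto simp: l2_def)

lemma
  assumes out: "\<And>x. x \<notin> X \<Longrightarrow> f x = 0"
    and bound: "\<And>A. finite A \<Longrightarrow> A \<subseteq> X \<Longrightarrow> L2_set (\<lambda>x. cmod (f x)) A \<le> B"
  shows l2_L2_setI: "f \<in> l2 X" and l2_norm_leI: "l2_norm X f \<le> B"
proof -
  have "0 \<le> B" using bound[of "{}"] by simp
  have sum_le: "(\<Sum>x\<in>A. (cmod (f x))\<^sup>2) \<le> B\<^sup>2" if "finite A" "A \<subseteq> X" for A
    using power_mono[OF bound[OF that] L2_set_nonneg, of 2] by (simp add: L2_set_def sum_nonneg)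
  have summable: "(\<lambda>x. (cmod (f x))\<^sup>2) summable_on X"
    by (rule nonneg_bdd_above_summable_on) (auto intro!: bdd_aboveI2 sum_le)
  with out show "f \<in> l2 X" by (simp add: l2_def)
  have "(l2_norm X f)\<^sup>2 \<le> B\<^sup>2"
    unfolding l2_norm_sq by (rule infsum_le_finite_sums[OF summable sum_le])
  then show "l2_norm X f \<le> B" using \<open>0 \<le> B\<close> by (rule power2_le_imp_le)
qed

lemma
  assumes "f \<in> l2 X" and "g \<in> l2 X"
  shows l2_add [simp]: "(\<lambda>x. f x + g x) \<in> l2 X"
    and l2_norm_triangle: "l2_norm X (\<lambda>x. f x + g x) \<le> l2_norm X f + l2_norm X g"
proof -
  have "L2_set (\<lambda>x. cmod (f x + g x)) A \<le> l2_norm X f + l2_norm X g" if "finite A" "A \<subseteq> X" for A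
  proof -
    have "L2_set (\<lambda>x. cmod (f x + g x)) A \<le> L2_set (\<lambda>x. cmod (f x) + cmod (g x)) A"
      by (intro L2_set_mono norm_triangle_ineq) simp
    also have "\<dots> \<le> L2_set (\<lambda>x. cmod (f x)) A + L2_set (\<lambda>x. cmod (g x)) A"
      by (rule L2_set_triangle_ineq)
    also have "\<dots> \<le> l2_norm X f + l2_norm X g"
      using assms that by (intro add_mono L2_set_le_l2_norm)
    finally show ?thesis .
  qed
  with assms show "(\<lambda>x. f x + g x) \<in> l2 X" "l2_norm X (\<lambda>x. f x + g x) \<le> l2_norm X f + l2_norm X g"
    by (auto intro!: l2_L2_setI l2_norm_leI simp: l2_outside)
qed

lemma
  assumes g: "g \<in> l2 X" and le: "\<And>x. x \<in> X \<Longrightarrow> cmod (f x) \<le> cmod (g x)"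
    and out: "\<And>x. x \<notin> X \<Longrightarrow> f x = 0"
  shows l2_dominated: "f \<in> l2 X" and l2_norm_mono: "l2_norm X f \<le> l2_norm X g"
proof -
  have "L2_set (\<lambda>x. cmod (f x)) A \<le> l2_norm X g" if "finite A" "A \<subseteq> X" for A
    using that le by (intro order_trans[OF L2_set_mono L2_set_le_l2_norm[OF g]]) auto
  with out show "f \<in> l2 X" "l2_norm X f \<le> l2_norm X g" by (auto intro!: l2_L2_setI l2_norm_leI)
qed

lemma l2_zero [simp]: "(\<lambda>x. 0) \<in> l2 X"
  by (simp add: l2_def)

lemma l2_scale [simp]: "f \<in> l2 X \<Longrightarrow> (\<lambda>x. c * f x) \<in> l2 X"
  using summable_on_cmult_right[of "\<lambda>x. (cmod (f x))\<^sup>2" X "(cmod c)\<^sup>2"]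
  by (simp add: l2_def norm_mult power_mult_distrib)

lemma l2_diff [simp]: "f \<in> l2 X \<Longrightarrow> g \<in> l2 X \<Longrightarrow> (\<lambda>x. f x - g x) \<in> l2 X"
  using l2_add[of f X "\<lambda>x. (-1) * g x"] l2_scale[of g X "-1"] by simp

lemma l2_sum [simp]: "(\<And>i. i \<in> I \<Longrightarrow> f i \<in> l2 X) \<Longrightarrow> (\<lambda>x. \<Sum>i\<in>I. f i x) \<in> l2 X"
  by (induction I rule: infinite_finite_induct) auto

lemma
  assumes "finite A" and "A \<subseteq> X" and "\<And>x. x \<notin> A \<Longrightarrow> f x = 0"
  shows l2_finite_support: "f \<in> l2 X"
    and l2_norm_finite_support: "l2_norm X f = L2_set (\<lambda>x. cmod (f x)) A"
proof -
  have "(\<lambda>x. (cmod (f x))\<^sup>2) summable_on X"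
    by (rule finite_nonzero_values_imp_summable_on, rule finite_subset[OF _ assms(1)])
       (use assms(3) in force)
  with assms show "f \<in> l2 X" by (auto simp: l2_def)
  have "(\<Sum>\<^sub>\<infinity>x\<in>X. (cmod (f x))\<^sup>2) = (\<Sum>\<^sub>\<infinity>x\<in>A. (cmod (f x))\<^sup>2)"
    by (rule infsum_cong_neutral) (use assms in auto)
  then show "l2_norm X f = L2_set (\<lambda>x. cmod (f x)) A"
    by (simp add: l2_norm_def L2_set_def assms(1))
qed

lemma l2_delta_in_l2 [simp]: "y \<in> X \<Longrightarrow> l2_delta y \<in> l2 X"
  by (rule l2_finite_support[of "{y}"]) (auto simp: l2_delta_def)

lemma l2_norm_delta: "y \<in> X \<Longrightarrow> l2_norm X (l2_delta y) = 1"
  by (subst l2_norm_finite_support[of "{y}"]) (auto simp: l2_delta_def)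

lemma cmod_le_l2_norm:
  assumes "f \<in> l2 X"
  shows "cmod (f x) \<le> l2_norm X f"
proof (cases "x \<in> X")
  case True
  then show ?thesis using L2_set_le_l2_norm[OF assms, of "{x}"] by simp
qed (simp add: l2_outside[OF assms])

lemma l2_norm_eq_0D: "f \<in> l2 X \<Longrightarrow> l2_norm X f = 0 \<Longrightarrow> f = (\<lambda>x. 0)"
  using cmod_le_l2_norm[of f X] by (simp add: fun_eq_iff)

lemma
  assumes "f \<in> l2 X" and "g \<in> l2 X"
  shows l2_product_abs_summable: "(\<lambda>x. cmod (f x * cnj (g x))) summable_on X"
    and l2_product_infsum_le: "(\<Sum>\<^sub>\<infinity>x\<in>X. cmod (f x * cnj (g x))) \<le> l2_norm X f * l2_norm X g"
proof -
  have sum_le: "(\<Sum>x\<in>A. cmod (f x * cnj (g x))) \<le> l2_norm X f * l2_norm X g"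
    if "finite A" "A \<subseteq> X" for A
  proof -
    have "(\<Sum>x\<in>A. cmod (f x * cnj (g x))) \<le> L2_set (\<lambda>x. cmod (f x)) A * L2_set (\<lambda>x. cmod (g x)) A"
      using L2_set_mult_ineq[of "\<lambda>x. cmod (f x)" "\<lambda>x. cmod (g x)" A] by (simp add: norm_mult)
    also have "\<dots> \<le> l2_norm X f * l2_norm X g"
      using assms that by (intro mult_mono L2_set_le_l2_norm) auto
    finally show ?thesis .
  qed
  then show "(\<lambda>x. cmod (f x * cnj (g x))) summable_on X"
    by (intro nonneg_bdd_above_summable_on) (auto intro!: bdd_aboveI2)
  then show "(\<Sum>\<^sub>\<infinity>x\<in>X. cmod (f x * cnj (g x))) \<le> l2_norm X f * l2_norm X g"
    using sum_le by (rule infsum_le_finite_sums)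
qed

lemma l2_product_summable:
  "f \<in> l2 X \<Longrightarrow> g \<in> l2 X \<Longrightarrow> (\<lambda>x. f x * cnj (g x)) summable_on X"
  by (rule abs_summable_summable) (rule l2_product_abs_summable)

lemma l2_Cauchy_Schwarz:
  assumes "f \<in> l2 X" and "g \<in> l2 X"
  shows "cmod (l2_inner X f g) \<le> l2_norm X f * l2_norm X g"
  unfolding l2_inner_def using norm_infsum_bound[OF l2_product_abs_summable[OF assms]]
    l2_product_infsum_le[OF assms] by (rule order_trans)

lemma l2_inner_add_left:
  "f \<in> l2 X \<Longrightarrow> g \<in> l2 X \<Longrightarrow> h \<in> l2 X \<Longrightarrow>
    l2_inner X (\<lambda>x. f x + g x) h = l2_inner X f h + l2_inner X g h"
  unfolding l2_inner_def distrib_right by (intro infsum_add l2_product_summable)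

lemma l2_inner_scale_left: "l2_inner X (\<lambda>x. c * f x) g = c * l2_inner X f g"
  unfolding l2_inner_def mult.assoc by (rule infsum_cmult_right')

lemma l2_inner_zero_left: "l2_inner X (\<lambda>x. 0) g = 0"
  by (simp add: l2_inner_def)

lemma l2_inner_diff_left:
  "f \<in> l2 X \<Longrightarrow> g \<in> l2 X \<Longrightarrow> h \<in> l2 X \<Longrightarrow>
    l2_inner X (\<lambda>x. f x - g x) h = l2_inner X f h - l2_inner X g h"
  using l2_inner_add_left[of f X "\<lambda>x. (-1) * g x" h] l2_scale[of g X "-1"]
  unfolding l2_inner_scale_left by simp

lemma l2_inner_sum_left:
  "(\<And>i. i \<in> I \<Longrightarrow> f i \<in> l2 X) \<Longrightarrow> g \<in> l2 X \<Longrightarrow>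
    l2_inner X (\<lambda>x. \<Sum>i\<in>I. f i x) g = (\<Sum>i\<in>I. l2_inner X (f i) g)"
  by (induction I rule: infinite_finite_induct)
     (simp_all add: l2_inner_zero_left l2_inner_add_left)

lemma l2_inner_commute: "l2_inner X g f = cnj (l2_inner X f g)"
  unfolding l2_inner_def infsum_cnj[symmetric] by (simp add: mult.commute)

lemma l2_inner_add_right:
  "f \<in> l2 X \<Longrightarrow> g \<in> l2 X \<Longrightarrow> h \<in> l2 X \<Longrightarrow>
    l2_inner X h (\<lambda>x. f x + g x) = l2_inner X h f + l2_inner X h g"
  by (simp add: l2_inner_commute[of X h] l2_inner_add_left)

lemma l2_inner_scale_right: "l2_inner X g (\<lambda>x. c * f x) = cnj c * l2_inner X g f"
  by (simp add: l2_inner_commute[of X g] l2_inner_scale_left)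

lemma l2_inner_self:
  assumes "f \<in> l2 X"
  shows "l2_inner X f f = complex_of_real ((l2_norm X f)\<^sup>2)"
proof -
  have "((\<lambda>x. (cmod (f x))\<^sup>2) has_sum (l2_norm X f)\<^sup>2) X"
    unfolding l2_norm_sq using assms by (simp add: l2_def)
  then have "((\<lambda>x. complex_of_real ((cmod (f x))\<^sup>2)) has_sum complex_of_real ((l2_norm X f)\<^sup>2)) X"
    by (rule has_sum_of_real)
  then show ?thesis unfolding l2_inner_def complex_norm_square by (rule infsumI)
qed

lemma Re_l2_inner_self: "f \<in> l2 X \<Longrightarrow> Re (l2_inner X f f) = (l2_norm X f)\<^sup>2"
  by (simp only: l2_inner_self Re_complex_of_real)

lemma l2_norm_add_sq:
  assumes "f \<in> l2 X" and "g \<in> l2 X"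
  shows "(l2_norm X (\<lambda>x. f x + g x))\<^sup>2
           = (l2_norm X f)\<^sup>2 + (l2_norm X g)\<^sup>2 + 2 * Re (l2_inner X f g)"
  using assms l2_inner_commute[of X g f]
  by (simp add: Re_l2_inner_self[symmetric] l2_inner_add_left l2_inner_add_right)

lemma l2_norm_diff_sq:
  assumes "f \<in> l2 X" and "g \<in> l2 X"
  shows "(l2_norm X (\<lambda>x. f x - g x))\<^sup>2
           = (l2_norm X f)\<^sup>2 + (l2_norm X g)\<^sup>2 - 2 * Re (l2_inner X f g)"
  using l2_norm_add_sq[of "\<lambda>x. f x - g x" X g] assms
  by (simp add: l2_inner_diff_left Re_l2_inner_self)

lemma l2_norm_diff_sq_le:
  assumes "f \<in> l2 X" and "g \<in> l2 X"
  shows "(l2_norm X (\<lambda>x. f x - g x))\<^sup>2 \<le> 2 * (l2_norm X f)\<^sup>2 + 2 * (l2_norm X g)\<^sup>2"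
  using l2_norm_add_sq[OF assms] l2_norm_diff_sq[OF assms]
    zero_le_power2[of "l2_norm X (\<lambda>x. f x + g x)"] by linarith

lemma
  fixes F :: "nat \<Rightarrow> 'a \<Rightarrow> complex"
  assumes F: "\<And>n. F n \<in> l2 X" and bound: "\<And>n. n \<ge> N \<Longrightarrow> l2_norm X (F n) \<le> B"
    and lim: "\<And>x. (\<lambda>n. F n x) \<longlonglongrightarrow> g x"
  shows l2_pointwise_limit: "g \<in> l2 X" and l2_norm_pointwise_limit: "l2_norm X g \<le> B"
proof -
  have "L2_set (\<lambda>x. cmod (g x)) A \<le> B" if "finite A" "A \<subseteq> X" for A
  proof (rule LIMSEQ_le_const2)
    show "(\<lambda>n. L2_set (\<lambda>x. cmod (F n x)) A) \<longlonglongrightarrow> L2_set (\<lambda>x. cmod (g x)) A"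
      unfolding L2_set_def by (intro tendsto_intros lim)
    show "\<exists>N. \<forall>n\<ge>N. L2_set (\<lambda>x. cmod (F n x)) A \<le> B"
      using L2_set_le_l2_norm[OF F that] bound by (meson order_trans)
  qed
  moreover have "g x = 0" if "x \<notin> X" for x
    using lim[of x] l2_outside[OF F that] by (simp add: LIMSEQ_const_iff)
  ultimately show "g \<in> l2 X" "l2_norm X g \<le> B" by (auto intro!: l2_L2_setI l2_norm_leI)
qed

definition l2_Cauchy :: "'a set \<Rightarrow> (nat \<Rightarrow> 'a \<Rightarrow> complex) \<Rightarrow> bool" where
  "l2_Cauchy X F \<longleftrightarrow> (\<forall>e>0. \<exists>N. \<forall>m\<ge>N. \<forall>n\<ge>N. l2_norm X (\<lambda>x. F m x - F n x) < e)"

lemma l2_Cauchy_pointwise: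
  assumes F: "\<And>n. F n \<in> l2 X" and "l2_Cauchy X F"
  shows "(\<lambda>n. F n x) \<longlonglongrightarrow> lim (\<lambda>n. F n x)"
proof -
  have "cmod (F m x - F n x) \<le> l2_norm X (\<lambda>x. F m x - F n x)" for m n
    using cmod_le_l2_norm[OF l2_diff[OF F F]] .
  with assms(2) have "Cauchy (\<lambda>n. F n x)"
    unfolding l2_Cauchy_def by (intro CauchyI) (meson le_less_trans)
  then show ?thesis using Cauchy_convergent convergent_LIMSEQ_iff by blast
qed

lemma
  fixes F :: "nat \<Rightarrow> 'a \<Rightarrow> complex"
  assumes F: "\<And>n. F n \<in> l2 X" and Cauchy: "l2_Cauchy X F" and lim: "\<And>x. (\<lambda>n. F n x) \<longlonglongrightarrow> g x"
  shows l2_Cauchy_limit: "g \<in> l2 X"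
    and l2_Cauchy_norm_tendsto: "(\<lambda>n. l2_norm X (\<lambda>x. F n x - g x)) \<longlonglongrightarrow> 0"
proof -
  have tail: "\<exists>N. \<forall>n\<ge>N. (\<lambda>x. F n x - g x) \<in> l2 X \<and> l2_norm X (\<lambda>x. F n x - g x) \<le> e"
    if "0 < e" for e
  proof -
    obtain N where N: "\<And>m n. m \<ge> N \<Longrightarrow> n \<ge> N \<Longrightarrow> l2_norm X (\<lambda>x. F m x - F n x) < e"
      using Cauchy \<open>0 < e\<close> unfolding l2_Cauchy_def by blast
    have diff_lim: "(\<lambda>m. F n x - F m x) \<longlonglongrightarrow> F n x - g x" for n x
      by (intro tendsto_intros lim)
    show ?thesis
      using l2_pointwise_limit[OF l2_diff[OF F F] less_imp_le[OF N] diff_lim]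
        l2_norm_pointwise_limit[OF l2_diff[OF F F] less_imp_le[OF N] diff_lim] by blast
  qed
  from tail[of 1] obtain n where "(\<lambda>x. F n x - g x) \<in> l2 X" by auto
  from l2_diff[OF F[of n] this] show "g \<in> l2 X" by simp
  show "(\<lambda>n. l2_norm X (\<lambda>x. F n x - g x)) \<longlonglongrightarrow> 0"
  proof (rule LIMSEQ_I)
    fix e :: real assume "0 < e"
    with tail[of "e / 2"] obtain N where N: "\<And>n. n \<ge> N \<Longrightarrow> l2_norm X (\<lambda>x. F n x - g x) \<le> e / 2"
      by auto
    have "norm (l2_norm X (\<lambda>x. F n x - g x) - 0) < e" if "n \<ge> N" for n
      using N[OF that] \<open>0 < e\<close> by simp
    then show "\<exists>N. \<forall>n\<ge>N. norm (l2_norm X (\<lambda>x. F n x - g x) - 0) < e" by blast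
  qed
qed

subsection \<open>Linear operators\<close>

locale l2_linear =
  fixes X :: "'a set" and A :: "('a \<Rightarrow> complex) \<Rightarrow> 'a \<Rightarrow> complex"
  assumes closed [simp]: "f \<in> l2 X \<Longrightarrow> A f \<in> l2 X"
    and add: "f \<in> l2 X \<Longrightarrow> g \<in> l2 X \<Longrightarrow> A (\<lambda>x. f x + g x) = (\<lambda>x. A f x + A g x)"
    and scale: "f \<in> l2 X \<Longrightarrow> A (\<lambda>x. b * f x) = (\<lambda>x. b * A f x)"
begin

lemma zero [simp]: "A (\<lambda>x. 0) = (\<lambda>x. 0)"
  using scale[of "\<lambda>x. 0" 0] by simp

lemma zero_quadratic_form_imp_zero:
  assumes quad: "\<And>f. f \<in> l2 X \<Longrightarrow> l2_inner X (A f) f = 0" and f: "f \<in> l2 X"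
  shows "A f = (\<lambda>x. 0)"
proof -
  have polar: "l2_inner X (A f) g + l2_inner X (A g) f = 0" if "f \<in> l2 X" "g \<in> l2 X" for f g
    using quad[OF l2_add[OF that]] that
    by (simp add: add l2_inner_add_left l2_inner_add_right quad)
  let ?g = "A f"
  have g: "?g \<in> l2 X" using f by simp
  have "\<i> * l2_inner X (A ?g) f - \<i> * l2_inner X (A f) ?g = 0"
    using polar[OF f l2_scale[OF g, of \<i>]] g
    by (simp add: scale l2_inner_scale_left l2_inner_scale_right)
  then have "\<i> * (l2_inner X (A ?g) f - l2_inner X (A f) ?g) = 0"
    by (simp only: right_diff_distrib)
  then have "l2_inner X (A ?g) f = l2_inner X (A f) ?g" by simp
  with polar[OF f g] have "l2_inner X (A f) ?g = 0" by simp
  then have "l2_norm X ?g = 0" using l2_inner_self[OF g] by simp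
  with g show ?thesis by (rule l2_norm_eq_0D)
qed

end

lemma l2_linear_diff:
  assumes "l2_linear X T" and "l2_linear X T'"
  shows "l2_linear X (\<lambda>f x. T f x - T' f x)"
proof -
  interpret T: l2_linear X T by fact
  interpret T': l2_linear X T' by fact
  show ?thesis
    by standard (simp_all add: T.add T'.add T.scale T'.scale fun_eq_iff algebra_simps)
qed

lemma l2_bounded_operator_iff:
  "l2_bounded_operator X T \<longleftrightarrow> l2_linear X T \<and> T \<in> extensional (l2 X) \<and>
     (\<exists>M. \<forall>f\<in>l2 X. l2_norm X (T f) \<le> M * l2_norm X f)"
  unfolding l2_bounded_operator_def l2_linear_def PiE_def by auto

lemma l2_bounded_operator_eqI:
  assumes T: "l2_bounded_operator X T" and T': "l2_bounded_operator X T'"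
    and eq: "\<And>f. f \<in> l2 X \<Longrightarrow> l2_inner X (T f) f = l2_inner X (T' f) f"
  shows "T = T'"
proof (rule extensionalityI)
  show "T \<in> extensional (l2 X)" "T' \<in> extensional (l2 X)"
    using T T' by (simp_all add: l2_bounded_operator_iff)
  interpret T: l2_linear X T using T by (simp add: l2_bounded_operator_iff)
  interpret T': l2_linear X T' using T' by (simp add: l2_bounded_operator_iff)
  interpret D: l2_linear X "\<lambda>f x. T f x - T' f x"
    by (rule l2_linear_diff[OF T.l2_linear_axioms T'.l2_linear_axioms])
  show "T f = T' f" if "f \<in> l2 X" for f
    using D.zero_quadratic_form_imp_zero[OF _ that]
    by (simp add: l2_inner_diff_left eq fun_eq_iff)
qed

subsection \<open>Polynomials of an operator\<close>

context l2_linear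
begin

definition op_poly :: "real poly \<Rightarrow> ('a \<Rightarrow> complex) \<Rightarrow> 'a \<Rightarrow> complex" where
  "op_poly p f = fold_coeffs (\<lambda>a g x. complex_of_real a * f x + A g x) p (\<lambda>x. 0)"

lemma op_poly_0 [simp]: "op_poly 0 f = (\<lambda>x. 0)"
  by (simp add: op_poly_def)

lemma op_poly_pCons: "op_poly (pCons a p) f = (\<lambda>x. complex_of_real a * f x + A (op_poly p f) x)"
  by (cases "p = 0 \<and> a = 0") (auto simp: op_poly_def)

lemma op_poly_1 [simp]: "op_poly 1 f = f"
  by (simp add: one_pCons op_poly_pCons)

lemma op_poly_closed [simp]: "f \<in> l2 X \<Longrightarrow> op_poly p f \<in> l2 X"
  by (induction p) (simp_all add: op_poly_pCons)

lemma op_poly_add: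
  "f \<in> l2 X \<Longrightarrow> op_poly (p + q) f = (\<lambda>x. op_poly p f x + op_poly q f x)"
  by (induction p q rule: poly_induct2) (simp_all add: op_poly_pCons add algebra_simps)

lemma op_poly_smult:
  "f \<in> l2 X \<Longrightarrow> op_poly (smult b p) f = (\<lambda>x. complex_of_real b * op_poly p f x)"
  by (induction p) (simp_all add: op_poly_pCons scale algebra_simps)

lemma op_poly_diff:
  "f \<in> l2 X \<Longrightarrow> op_poly (p - q) f = (\<lambda>x. op_poly p f x - op_poly q f x)"
  using op_poly_add[of f "p - q" q] by (simp add: fun_eq_iff)

lemma op_poly_mult: "f \<in> l2 X \<Longrightarrow> op_poly (p * q) f = op_poly p (op_poly q f)"
  by (induction p) (simp_all add: op_poly_add op_poly_smult op_poly_pCons)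

lemma op_poly_monom: "op_poly (monom 1 n) f = (A ^^ n) f"
  by (induction n) (simp_all add: monom_0 monom_Suc op_poly_pCons flip: one_pCons)

lemma l2_linear_op_poly: "l2_linear X (op_poly p)"
proof
  show "op_poly p f \<in> l2 X" if "f \<in> l2 X" for f using that by simp
  show "op_poly p (\<lambda>x. f x + g x) = (\<lambda>x. op_poly p f x + op_poly p g x)"
    if "f \<in> l2 X" "g \<in> l2 X" for f g
    using that by (induction p) (simp_all add: op_poly_pCons add algebra_simps)
  show "op_poly p (\<lambda>x. b * f x) = (\<lambda>x. b * op_poly p f x)" if "f \<in> l2 X" for b f
    using that by (induction p) (simp_all add: op_poly_pCons scale algebra_simps)
qed

end

locale l2_positive_operator = l2_linear +
  fixes c :: real
  assumes c_pos: "0 < c"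
    and sym: "f \<in> l2 X \<Longrightarrow> g \<in> l2 X \<Longrightarrow> l2_inner X (A f) g = l2_inner X f (A g)"
    and nonneg: "f \<in> l2 X \<Longrightarrow> 0 \<le> Re (l2_inner X (A f) f)"
    and le_bound: "f \<in> l2 X \<Longrightarrow> Re (l2_inner X (A f) f) \<le> c * (l2_norm X f)\<^sup>2"
begin

lemma op_poly_sym:
  assumes f: "f \<in> l2 X" and "g \<in> l2 X"
  shows "l2_inner X (op_poly p f) g = l2_inner X f (op_poly p g)"
  using assms(2)
proof (induction p arbitrary: g)
  case 0
  show ?case by (simp add: l2_inner_def)
next
  case (pCons a p)
  have "op_poly p (op_poly [:0, 1:] g) = op_poly [:0, 1:] (op_poly p g)"
    using pCons.prems by (simp add: op_poly_mult[symmetric] mult.commute)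
  then have "op_poly p (A g) = A (op_poly p g)" by (simp add: op_poly_pCons)
  with pCons f show ?case
    by (simp add: op_poly_pCons l2_inner_add_left l2_inner_add_right l2_inner_scale_left
        l2_inner_scale_right sym)
qed

definition op_poly_form :: "('a \<Rightarrow> complex) \<Rightarrow> real poly \<Rightarrow> real" where
  "op_poly_form f p = Re (l2_inner X (op_poly p f) f)"

lemma inner_op_poly:
  assumes "f \<in> l2 X"
  shows "l2_inner X (op_poly p f) f = complex_of_real (op_poly_form f p)"
proof -
  have "l2_inner X (op_poly p f) f = cnj (l2_inner X (op_poly p f) f)"
    using op_poly_sym[OF assms assms, of p] l2_inner_commute[of X f] by metis
  then show ?thesis by (simp add: op_poly_form_def complex_eq_iff)
qed

lemma real_poly_functional_op_poly_form: "f \<in> l2 X \<Longrightarrow> real_poly_functional (op_poly_form f)"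
  by standard
     (simp_all add: op_poly_form_def op_poly_add op_poly_smult l2_inner_add_left
        l2_inner_scale_left)

lemma op_poly_form_square_mult:
  assumes f: "f \<in> l2 X"
  shows "op_poly_form f (q\<^sup>2 * p) = op_poly_form (op_poly q f) p"
proof -
  have "op_poly (q\<^sup>2 * p) f = op_poly q (op_poly p (op_poly q f))"
    using f by (simp add: op_poly_mult[symmetric] power2_eq_square mult_ac)
  with f show ?thesis by (simp add: op_poly_form_def op_poly_sym)
qed

lemma op_poly_form_1: "f \<in> l2 X \<Longrightarrow> op_poly_form f 1 = (l2_norm X f)\<^sup>2"
  by (simp add: op_poly_form_def Re_l2_inner_self)

lemma op_poly_form_square: "f \<in> l2 X \<Longrightarrow> op_poly_form f (q\<^sup>2) = (l2_norm X (op_poly q f))\<^sup>2"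
  using op_poly_form_square_mult[of f q 1] by (simp add: op_poly_form_1)

lemma op_poly_form_linear_nonneg:
  assumes f: "f \<in> l2 X"
  shows "0 \<le> op_poly_form f [:0, 1:]" and "0 \<le> op_poly_form f [:c, -1:]"
proof -
  interpret real_poly_functional "op_poly_form f" by (rule real_poly_functional_op_poly_form[OF f])
  show X: "0 \<le> op_poly_form f [:0, 1:]"
    using nonneg[OF f] by (simp add: op_poly_form_def op_poly_pCons)
  have "[:c, -1:] = smult c 1 - [:0, 1:]" by (simp add: one_pCons)
  then have "op_poly_form f [:c, -1:] = c * (l2_norm X f)\<^sup>2 - Re (l2_inner X (A f) f)"
    by (simp only: diff smult op_poly_form_1[OF f]) (simp add: op_poly_form_def op_poly_pCons)
  with le_bound[OF f] show "0 \<le> op_poly_form f [:c, -1:]" by simp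
qed

lemma op_poly_form_product_nonneg:
  assumes "f \<in> l2 X"
  shows "0 \<le> op_poly_form f ([:0, 1:] * [:c, -1:])"
proof -
  let ?P = "[:0, 1:]" and ?Q = "[:c, -1:]"
  interpret real_poly_functional "op_poly_form f"
    by (rule real_poly_functional_op_poly_form[OF assms])
  have "smult c (?P * ?Q) = ?P\<^sup>2 * ?Q + ?Q\<^sup>2 * ?P"
    by (simp add: power2_eq_square algebra_simps)
  then have "c * op_poly_form f (?P * ?Q)
      = op_poly_form (op_poly ?P f) ?Q + op_poly_form (op_poly ?Q f) ?P"
    by (simp only: smult[symmetric] add op_poly_form_square_mult[OF assms])
  also have "\<dots> \<ge> 0"
    using assms by (intro add_nonneg_nonneg op_poly_form_linear_nonneg op_poly_closed)
  finally show ?thesis using c_pos by (simp add: zero_le_mult_iff)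
qed

text \<open>Even powers are absorbed into \<open>f\<close>, so only the exponents \<open>0\<close> and \<open>1\<close> matter.\<close>

lemma interval_positive_functional_op_poly_form:
  assumes f: "f \<in> l2 X"
  shows "interval_positive_functional (op_poly_form f) c"
proof (intro interval_positive_functional.intro interval_positive_functional_axioms.intro
    real_poly_functional_op_poly_form f c_pos)
  fix k l :: nat
  let ?P = "[:0, 1:] :: real poly" and ?Q = "[:c, -1:]"
  have square: "p ^ n = (p ^ (n div 2))\<^sup>2 * p ^ (n mod 2)" for p :: "real poly" and n
    by (simp only: power_mult[symmetric] power_add[symmetric]) simp
  define g where "g = op_poly (?P ^ (k div 2) * ?Q ^ (l div 2)) f"
  have g: "g \<in> l2 X" using f by (simp add: g_def)
  have "?P ^ k * ?Q ^ l
      = (?P ^ (k div 2) * ?Q ^ (l div 2))\<^sup>2 * (?P ^ (k mod 2) * ?Q ^ (l mod 2))"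
    by (subst square[of ?P k], subst square[of ?Q l]) (simp only: power_mult_distrib mult_ac)
  then have "op_poly_form f (?P ^ k * ?Q ^ l) = op_poly_form g (?P ^ (k mod 2) * ?Q ^ (l mod 2))"
    by (simp only: op_poly_form_square_mult[OF f] g_def)
  also have "\<dots> \<ge> 0"
  proof -
    have "k mod 2 = 0 \<or> k mod 2 = 1" "l mod 2 = 0 \<or> l mod 2 = 1" by auto
    moreover have "0 \<le> op_poly_form g 1" using op_poly_form_1[OF g] by simp
    ultimately show ?thesis
      using op_poly_form_linear_nonneg[OF g] op_poly_form_product_nonneg[OF g]
      by (elim disjE) (simp_all only: power_0 power_one_right mult_1_left mult_1_right)
  qed
  finally show "0 \<le> op_poly_form f (?P ^ k * ?Q ^ l)" .
qed

subsection \<open>The spectral measure and the functional calculus\<close>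

definition is_spectral_measure :: "('a \<Rightarrow> complex) \<Rightarrow> real measure \<Rightarrow> bool" where
  "is_spectral_measure f \<mu> \<longleftrightarrow> bounded_borel_measure \<mu> c \<and>
     (\<forall>n. l2_inner X ((A ^^ n) f) f = complex_of_real (\<integral>x. x ^ n \<partial>\<mu>))"

lemma is_spectral_measure_exists:
  assumes "f \<in> l2 X"
  shows "\<exists>\<mu>. is_spectral_measure f \<mu>"
  using interval_positive_functional.representing_measure_exists[OF
      interval_positive_functional_op_poly_form[OF assms]] inner_op_poly[OF assms]
  unfolding is_spectral_measure_def op_poly_monom[symmetric] by metis

lemma is_spectral_measure_l2_spectral_measure:
  assumes "f \<in> l2 X"
  shows "is_spectral_measure f (l2_spectral_measure X A f)"
proof -
  obtain \<mu> where \<mu>: "is_spectral_measure f \<mu>" using is_spectral_measure_exists[OF assms] ..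
  then interpret \<mu>: bounded_borel_measure \<mu> c by (simp add: is_spectral_measure_def)
  have "l2_spectral_measure X A f = \<mu>"
    unfolding l2_spectral_measure_def
  proof (rule the_equality)
    show "sets \<mu> = sets borel \<and> finite_measure \<mu> \<and> (\<exists>r. AE x in \<mu>. \<bar>x\<bar> \<le> r) \<and>
        (\<forall>n. l2_inner X ((A ^^ n) f) f = complex_of_real (\<integral>x. x ^ n \<partial>\<mu>))"
      using \<mu> \<mu>.AE_bounded \<mu>.M_is_borel \<mu>.finite_measure_axioms
      by (auto simp: is_spectral_measure_def)
    fix \<nu>
    assume \<nu>: "sets \<nu> = sets borel \<and> finite_measure \<nu> \<and> (\<exists>r. AE x in \<nu>. \<bar>x\<bar> \<le> r) \<and>
        (\<forall>n. l2_inner X ((A ^^ n) f) f = complex_of_real (\<integral>x. x ^ n \<partial>\<nu>))"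
    then obtain r where "bounded_borel_measure \<nu> r" by (auto intro: bounded_borel_measureI)
    then show "\<nu> = \<mu>"
      by (rule moments_determine_measure[OF _ \<mu>.bounded_borel_measure_axioms])
         (use \<mu> \<nu> in \<open>simp add: is_spectral_measure_def\<close>)
  qed
  with \<mu> show ?thesis by simp
qed

lemma bounded_borel_measure_spectral:
  "f \<in> l2 X \<Longrightarrow> bounded_borel_measure (l2_spectral_measure X A f) c"
  using is_spectral_measure_l2_spectral_measure by (simp add: is_spectral_measure_def)

lemma op_poly_form_eq_integral:
  assumes f: "f \<in> l2 X"
  shows "op_poly_form f p = (\<integral>x. poly p x \<partial>l2_spectral_measure X A f)"
proof (rule real_poly_functional_eqI)
  interpret bounded_borel_measure "l2_spectral_measure X A f" c
    by (rule bounded_borel_measure_spectral[OF f])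
  show "real_poly_functional (\<lambda>p. \<integral>x. poly p x \<partial>l2_spectral_measure X A f)"
    by (rule real_poly_functional_integral)
  show "op_poly_form f (monom 1 n) = (\<integral>x. poly (monom 1 n) x \<partial>l2_spectral_measure X A f)" for n
    using is_spectral_measure_l2_spectral_measure[OF f]
    by (simp add: is_spectral_measure_def op_poly_form_def op_poly_monom poly_monom)
qed (rule real_poly_functional_op_poly_form[OF f])

lemma l2_norm_op_poly:
  assumes "f \<in> l2 X"
  shows "(l2_norm X (op_poly p f))\<^sup>2 = (\<integral>x. (poly p x)\<^sup>2 \<partial>l2_spectral_measure X A f)"
  using op_poly_form_square[OF assms, of p] op_poly_form_eq_integral[OF assms, of "p\<^sup>2"] by simp

lemma l2_norm_op_poly_le:
  assumes f: "f \<in> l2 X" and B: "\<And>x. \<bar>x\<bar> \<le> c \<Longrightarrow> \<bar>poly p x\<bar> \<le> B"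
  shows "l2_norm X (op_poly p f) \<le> B * l2_norm X f"
proof (rule power2_le_imp_le)
  define \<mu> where "\<mu> = l2_spectral_measure X A f"
  interpret bounded_borel_measure \<mu> c
    unfolding \<mu>_def by (rule bounded_borel_measure_spectral[OF f])
  have "0 \<le> B" using B[of 0] c_pos by simp
  then show "0 \<le> B * l2_norm X f" by simp
  have square_le: "(poly p x)\<^sup>2 \<le> B\<^sup>2" if "\<bar>x\<bar> \<le> c" for x
    using B[OF that] \<open>0 \<le> B\<close> by (simp add: abs_le_square_iff[symmetric])
  have "(l2_norm X (op_poly p f))\<^sup>2 = (\<integral>x. (poly p x)\<^sup>2 \<partial>\<mu>)"
    unfolding \<mu>_def by (rule l2_norm_op_poly[OF f])
  also have "\<dots> \<le> (\<integral>x. B\<^sup>2 \<partial>\<mu>)"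
    using AE_bounded square_le
    by (intro integral_mono_AE integrable_poly_square) (auto elim: eventually_mono)
  also have "\<dots> = B\<^sup>2 * (\<integral>x. (poly 1 x)\<^sup>2 \<partial>\<mu>)" by simp
  also have "\<dots> = (B * l2_norm X f)\<^sup>2"
    unfolding \<mu>_def l2_norm_op_poly[OF f, symmetric] by (simp add: power_mult_distrib)
  finally show "(l2_norm X (op_poly p f))\<^sup>2 \<le> (B * l2_norm X f)\<^sup>2" .
qed

lemma l2_norm_op_poly_diff_le:
  assumes f: "f \<in> l2 X" and p: "bounded_poly_limit c p h" and h: "h \<in> borel_measurable borel"
  defines "err \<equiv> \<lambda>n. \<integral>x. (poly (p n) x - h x)\<^sup>2 \<partial>l2_spectral_measure X A f"
  shows "(l2_norm X (\<lambda>x. op_poly (p m) f x - op_poly (p n) f x))\<^sup>2 \<le> 2 * err m + 2 * err n"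
proof -
  define \<mu> where "\<mu> = l2_spectral_measure X A f"
  interpret bounded_borel_measure \<mu> c
    unfolding \<mu>_def by (rule bounded_borel_measure_spectral[OF f])
  note integrable_err = integrable_poly_diff_sq[OF p h]
  have square_sum: "(a - b)\<^sup>2 \<le> 2 * (a - d)\<^sup>2 + 2 * (b - d)\<^sup>2" for a b d :: real
    using zero_le_power2[of "(a - d) + (b - d)"] by (simp add: power2_eq_square algebra_simps)
  have "(l2_norm X (\<lambda>x. op_poly (p m) f x - op_poly (p n) f x))\<^sup>2
      = (\<integral>x. (poly (p m - p n) x)\<^sup>2 \<partial>\<mu>)"
    unfolding \<mu>_def l2_norm_op_poly[OF f, symmetric] using f by (simp add: op_poly_diff)
  also have "\<dots> \<le> (\<integral>x. 2 * (poly (p m) x - h x)\<^sup>2 + 2 * (poly (p n) x - h x)\<^sup>2 \<partial>\<mu>)"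
    by (intro integral_mono integrable_poly_square Bochner_Integration.integrable_add
        integrable_mult_right integrable_err) (simp add: square_sum)
  also have "\<dots> = 2 * err m + 2 * err n" by (simp add: err_def \<mu>_def[symmetric] integrable_err)
  finally show ?thesis .
qed

lemma l2_Cauchy_op_poly:
  assumes f: "f \<in> l2 X" and p: "bounded_poly_limit c p h" and h: "h \<in> borel_measurable borel"
  shows "l2_Cauchy X (\<lambda>n. op_poly (p n) f)"
  unfolding l2_Cauchy_def
proof (intro allI impI)
  fix e :: real assume e: "0 < e"
  define err where "err n = (\<integral>x. (poly (p n) x - h x)\<^sup>2 \<partial>l2_spectral_measure X A f)" for n
  have "err \<longlonglongrightarrow> 0"
    unfolding err_def using bounded_borel_measure_spectral[OF f] p h
    by (rule bounded_borel_measure.integral_poly_diff_sq_tendsto)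
  then have "\<forall>\<^sub>F n in sequentially. err n < e\<^sup>2 / 4"
    by (rule order_tendstoD(2)) (use e in simp)
  then obtain N where N: "\<And>n. n \<ge> N \<Longrightarrow> err n < e\<^sup>2 / 4"
    unfolding eventually_sequentially by blast
  have "l2_norm X (\<lambda>x. op_poly (p m) f x - op_poly (p n) f x) < e" if "m \<ge> N" "n \<ge> N" for m n
  proof (rule power2_less_imp_less)
    show "(l2_norm X (\<lambda>x. op_poly (p m) f x - op_poly (p n) f x))\<^sup>2 < e\<^sup>2"
      using l2_norm_op_poly_diff_le[OF f p h, of m n, folded err_def] N[OF that(1)] N[OF that(2)]
      by linarith
  qed (use e in simp)
  then show "\<exists>N. \<forall>m\<ge>N. \<forall>n\<ge>N. l2_norm X (\<lambda>x. op_poly (p m) f x - op_poly (p n) f x) < e"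
    by blast
qed

definition strong_limit :: "(nat \<Rightarrow> real poly) \<Rightarrow> ('a \<Rightarrow> complex) \<Rightarrow> 'a \<Rightarrow> complex" where
  "strong_limit p = (\<lambda>f\<in>l2 X. \<lambda>x. lim (\<lambda>n. op_poly (p n) f x))"

context
  fixes p :: "nat \<Rightarrow> real poly" and h :: "real \<Rightarrow> real"
  assumes p: "bounded_poly_limit c p h" and h: "h \<in> borel_measurable borel"
begin

lemma strong_limit_pointwise:
  assumes "f \<in> l2 X"
  shows "(\<lambda>n. op_poly (p n) f x) \<longlonglongrightarrow> strong_limit p f x"
  using l2_Cauchy_pointwise[OF _ l2_Cauchy_op_poly[OF assms p h]] assms
  by (simp add: strong_limit_def)

lemma strong_limit_closed: "f \<in> l2 X \<Longrightarrow> strong_limit p f \<in> l2 X"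
  by (rule l2_Cauchy_limit[OF _ l2_Cauchy_op_poly[OF _ p h] strong_limit_pointwise]) simp_all

lemma strong_limit_norm_tendsto:
  "f \<in> l2 X \<Longrightarrow> (\<lambda>n. l2_norm X (\<lambda>x. op_poly (p n) f x - strong_limit p f x)) \<longlonglongrightarrow> 0"
  by (rule l2_Cauchy_norm_tendsto[OF _ l2_Cauchy_op_poly[OF _ p h] strong_limit_pointwise]) simp_all

lemma l2_linear_strong_limit: "l2_linear X (strong_limit p)"
proof
  show "strong_limit p f \<in> l2 X" if "f \<in> l2 X" for f using that by (rule strong_limit_closed)
  show "strong_limit p (\<lambda>x. f x + g x) = (\<lambda>x. strong_limit p f x + strong_limit p g x)"
    if f: "f \<in> l2 X" and g: "g \<in> l2 X" for f g
  proof
    fix x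
    have "(\<lambda>n. op_poly (p n) f x + op_poly (p n) g x) \<longlonglongrightarrow> strong_limit p (\<lambda>x. f x + g x) x"
      using strong_limit_pointwise[OF l2_add[OF f g], of x] f g
      by (simp add: l2_linear.add[OF l2_linear_op_poly])
    then show "strong_limit p (\<lambda>x. f x + g x) x = strong_limit p f x + strong_limit p g x"
      by (rule LIMSEQ_unique) (intro tendsto_intros strong_limit_pointwise f g)
  qed
  show "strong_limit p (\<lambda>x. b * f x) = (\<lambda>x. b * strong_limit p f x)" if f: "f \<in> l2 X" for b f
  proof
    fix x
    have "(\<lambda>n. b * op_poly (p n) f x) \<longlonglongrightarrow> strong_limit p (\<lambda>x. b * f x) x"
      using strong_limit_pointwise[OF l2_scale[OF f], of b x] f
      by (simp add: l2_linear.scale[OF l2_linear_op_poly])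
    then show "strong_limit p (\<lambda>x. b * f x) x = b * strong_limit p f x"
      by (rule LIMSEQ_unique) (intro tendsto_intros strong_limit_pointwise f)
  qed
qed

lemma l2_bounded_operator_strong_limit: "l2_bounded_operator X (strong_limit p)"
proof -
  obtain B where B: "\<And>n x. \<bar>x\<bar> \<le> c \<Longrightarrow> \<bar>poly (p n) x\<bar> \<le> B"
    using p by (rule bounded_poly_limitE) blast
  have "l2_norm X (strong_limit p f) \<le> B * l2_norm X f" if f: "f \<in> l2 X" for f
    by (rule l2_norm_pointwise_limit[OF _ l2_norm_op_poly_le[OF f B] strong_limit_pointwise[OF f]])
       (use f in auto)
  then show ?thesis
    using l2_linear_strong_limit by (auto simp: l2_bounded_operator_iff strong_limit_def)
qed

lemma strong_limit_inner:
  assumes f: "f \<in> l2 X"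
  shows "l2_inner X (strong_limit p f) f
           = complex_of_real (\<integral>x. h x \<partial>l2_spectral_measure X A f)"
proof (rule LIMSEQ_unique)
  note spectral = bounded_borel_measure_spectral[OF f]
  show "(\<lambda>n. complex_of_real (op_poly_form f (p n)))
      \<longlonglongrightarrow> complex_of_real (\<integral>x. h x \<partial>l2_spectral_measure X A f)"
    unfolding op_poly_form_eq_integral[OF f]
    by (rule tendsto_of_real[OF bounded_borel_measure.integral_poly_tendsto[OF spectral p h]])
  have "(\<lambda>n. l2_inner X (op_poly (p n) f) f - l2_inner X (strong_limit p f) f) \<longlonglongrightarrow> 0"
  proof (rule Lim_null_comparison)
    have "cmod (l2_inner X (op_poly (p n) f) f - l2_inner X (strong_limit p f) f)
        \<le> l2_norm X (\<lambda>x. op_poly (p n) f x - strong_limit p f x) * l2_norm X f" for n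
      using l2_Cauchy_Schwarz[OF l2_diff[OF op_poly_closed[OF f] strong_limit_closed[OF f]] f,
          of "p n"]
      by (simp add: l2_inner_diff_left strong_limit_closed f)
    then show "\<forall>\<^sub>F n in sequentially.
        cmod (l2_inner X (op_poly (p n) f) f - l2_inner X (strong_limit p f) f)
          \<le> l2_norm X (\<lambda>x. op_poly (p n) f x - strong_limit p f x) * l2_norm X f" by simp
    show "(\<lambda>n. l2_norm X (\<lambda>x. op_poly (p n) f x - strong_limit p f x) * l2_norm X f) \<longlonglongrightarrow> 0"
      by (rule tendsto_mult_left_zero[OF strong_limit_norm_tendsto[OF f]])
  qed
  then show "(\<lambda>n. complex_of_real (op_poly_form f (p n))) \<longlonglongrightarrow> l2_inner X (strong_limit p f) f"
    by (simp add: LIM_zero_iff inner_op_poly[OF f])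
qed

lemma functional_calculus_inner:
  assumes f: "f \<in> l2 X"
  shows "l2_inner X (l2_functional_calculus X A (\<lambda>x. complex_of_real (h x)) f) f
           = complex_of_real (\<integral>x. h x \<partial>l2_spectral_measure X A f)"
proof -
  have "l2_functional_calculus X A (\<lambda>x. complex_of_real (h x)) = strong_limit p"
    unfolding l2_functional_calculus_def
  proof (rule the_equality)
    show "l2_bounded_operator X (strong_limit p) \<and> (\<forall>f\<in>l2 X. l2_inner X (strong_limit p f) f
        = (\<integral>x. complex_of_real (h x) \<partial>l2_spectral_measure X A f))"
      by (simp add: l2_bounded_operator_strong_limit strong_limit_inner)
    show "T = strong_limit p" if "l2_bounded_operator X T \<and> (\<forall>f\<in>l2 X. l2_inner X (T f) f
        = (\<integral>x. complex_of_real (h x) \<partial>l2_spectral_measure X A f))" for T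
      using that
      by (intro l2_bounded_operator_eqI[of X] l2_bounded_operator_strong_limit)
         (simp_all add: strong_limit_inner)
  qed
  then show ?thesis by (simp add: strong_limit_inner[OF f])
qed

end

lemma spectral_projection_inner:
  assumes f: "f \<in> l2 X"
  shows "l2_inner X (l2_functional_calculus X A (indicator {..a}) f) f
           = complex_of_real (measure (l2_spectral_measure X A f) {..a})"
proof -
  interpret bounded_borel_measure "l2_spectral_measure X A f" c
    by (rule bounded_borel_measure_spectral[OF f])
  obtain p where p: "bounded_poly_limit c p (indicator {..a})"
    using indicator_atMost_bounded_poly_limit by blast
  have "(indicator {..a} :: real \<Rightarrow> complex) = (\<lambda>x. complex_of_real (indicator {..a} x))"
    by (simp add: fun_eq_iff indicator_def)
  then show ?thesis using functional_calculus_inner[OF p _ f] by (simp add: borel_UNIV)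
qed

end

subsection \<open>Summable functions and soft thresholding\<close>

definition l1_ball :: "'a set \<Rightarrow> real \<Rightarrow> ('a \<Rightarrow> complex) set" where
  "l1_ball X m = {f. \<forall>A. finite A \<longrightarrow> A \<subseteq> X \<longrightarrow> (\<Sum>x\<in>A. cmod (f x)) \<le> m}"

lemma l1_ballD: "f \<in> l1_ball X m \<Longrightarrow> finite A \<Longrightarrow> A \<subseteq> X \<Longrightarrow> (\<Sum>x\<in>A. cmod (f x)) \<le> m"
  by (simp add: l1_ball_def)

lemma
  assumes f: "f \<in> l1_ball X m" and a: "0 < a"
  shows finite_superlevel: "finite {x\<in>X. a < cmod (f x)}"
    and card_superlevel_le: "real (card {x\<in>X. a < cmod (f x)}) \<le> m / a"
proof -
  have card_le: "real (card A) \<le> m / a" if A: "A \<subseteq> {x\<in>X. a < cmod (f x)}" "finite A" for A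
  proof -
    have "real (card A) * a \<le> (\<Sum>x\<in>A. cmod (f x))"
      using A sum_mono[of A "\<lambda>_. a" "\<lambda>x. cmod (f x)"] by force
    also have "\<dots> \<le> m" using A by (intro l1_ballD[OF f]) auto
    finally show ?thesis using a by (simp add: field_simps)
  qed
  then show finite: "finite {x\<in>X. a < cmod (f x)}"
    using finite_if_finite_subsets_card_bdd[of _ "nat \<lceil>m / a\<rceil>"]
    by (meson of_nat_le_iff order_trans real_nat_ceiling_ge)
  show "real (card {x\<in>X. a < cmod (f x)}) \<le> m / a" by (rule card_le[OF subset_refl finite])
qed

definition soft_threshold :: "real \<Rightarrow> ('a \<Rightarrow> complex) \<Rightarrow> 'a \<Rightarrow> complex" where
  "soft_threshold a f = (\<lambda>x. complex_of_real (max 0 (cmod (f x) - a)))"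

lemma soft_threshold_contraction:
  "cmod (soft_threshold a f x - soft_threshold a f y) \<le> cmod (f x - f y)"
proof -
  have "cmod (soft_threshold a f x - soft_threshold a f y)
      = \<bar>max 0 (cmod (f x) - a) - max 0 (cmod (f y) - a)\<bar>"
    unfolding soft_threshold_def of_real_diff[symmetric] norm_of_real ..
  also have "\<dots> \<le> \<bar>cmod (f x) - cmod (f y)\<bar>" by auto
  also have "\<dots> \<le> cmod (f x - f y)" by (rule norm_triangle_ineq3)
  finally show ?thesis .
qed

lemma soft_threshold_l2: "f \<in> l2 X \<Longrightarrow> 0 \<le> a \<Longrightarrow> soft_threshold a f \<in> l2 X"
  by (rule l2_dominated) (auto simp: soft_threshold_def l2_outside)

lemma l2_norm_le_soft_threshold:
  assumes f: "f \<in> l2 X" "f \<in> l1_ball X m" and a: "0 \<le> a"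
  shows "(l2_norm X f)\<^sup>2 \<le> (l2_norm X (soft_threshold a f))\<^sup>2 + 2 * a * m"
proof -
  let ?k = "soft_threshold a f"
  have "v\<^sup>2 - (max 0 (v - a))\<^sup>2 \<le> 2 * a * v" if "0 \<le> v" for v
  proof (cases "v \<le> a")
    case True
    then have "v * v \<le> 2 * a * v" using that a by (intro mult_right_mono) auto
    with True show ?thesis by (simp add: power2_eq_square)
  next
    case False
    then show ?thesis by (simp add: power2_eq_square algebra_simps)
  qed
  then have loss: "(cmod (f x))\<^sup>2 \<le> (cmod (?k x))\<^sup>2 + 2 * a * cmod (f x)" for x
    unfolding soft_threshold_def norm_of_real by (simp add: diff_le_eq add.commute)
  show ?thesis
    unfolding l2_norm_sq[of X f]
  proof (rule infsum_le_finite_sums)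
    show "(\<lambda>x. (cmod (f x))\<^sup>2) summable_on X" using f(1) by (simp add: l2_def)
    fix A assume A: "finite A" "A \<subseteq> X"
    have "(\<Sum>x\<in>A. (cmod (f x))\<^sup>2) \<le> (\<Sum>x\<in>A. (cmod (?k x))\<^sup>2) + 2 * a * (\<Sum>x\<in>A. cmod (f x))"
      unfolding sum_distrib_left sum.distrib[symmetric] by (intro sum_mono loss)
    also have "\<dots> \<le> (l2_norm X ?k)\<^sup>2 + 2 * a * m"
    proof (intro add_mono mult_left_mono)
      show "(\<Sum>x\<in>A. (cmod (?k x))\<^sup>2) \<le> (l2_norm X ?k)\<^sup>2"
        using power_mono[OF L2_set_le_l2_norm[OF soft_threshold_l2[OF f(1) a] A] L2_set_nonneg,
            of 2]
        by (simp add: L2_set_def sum_nonneg)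
    qed (use l1_ballD[OF f(2) A] a in auto)
    finally show "(\<Sum>x\<in>A. (cmod (f x))\<^sup>2) \<le> (l2_norm X ?k)\<^sup>2 + 2 * a * m" .
  qed
qed

subsection \<open>The Laplace operator of a finite symmetric set\<close>

locale symmetric_walk = group G for G (structure) +
  fixes S
  assumes finite_S: "finite S" and S_carrier: "S \<subseteq> carrier G" and S_nonempty: "S \<noteq> {}"
    and S_inv: "s \<in> S \<Longrightarrow> inv s \<in> S"
begin

abbreviation lap where "lap \<equiv> laplace_operator G (uniform_weight S)"

abbreviation l2G where "l2G \<equiv> l2 (carrier G)"

abbreviation normG where "normG \<equiv> l2_norm (carrier G)"

abbreviation innerG where "innerG \<equiv> l2_inner (carrier G)"

definition shift :: "'a \<Rightarrow> ('a \<Rightarrow> complex) \<Rightarrow> 'a \<Rightarrow> complex" where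
  "shift s f = (\<lambda>x. if x \<in> carrier G then f (x \<otimes> s) else 0)"

lemma card_S_pos: "0 < card S"
  using finite_S S_nonempty by (simp add: card_gt_0_iff)

lemma S_memD: "s \<in> S \<Longrightarrow> s \<in> carrier G"
  using S_carrier by blast

lemma bij_right_mult: "s \<in> carrier G \<Longrightarrow> bij_betw (\<lambda>x. x \<otimes> s) (carrier G) (carrier G)"
  by (rule bij_betw_byWitness[where f' = "\<lambda>x. x \<otimes> inv s"]) (auto simp: m_assoc)

lemma bij_inv_S: "bij_betw (m_inv G) S S"
  by (rule bij_betw_byWitness[where f' = "m_inv G"]) (use S_inv S_carrier in auto)

lemma
  assumes s: "s \<in> carrier G" and f: "f \<in> l2G"
  shows shift_l2: "shift s f \<in> l2G" and l2_norm_shift: "normG (shift s f) = normG f"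
proof -
  have shifted: "(cmod (shift s f x))\<^sup>2 = (cmod (f (x \<otimes> s)))\<^sup>2" if "x \<in> carrier G" for x
    using that by (simp add: shift_def)
  have "(\<lambda>x. (cmod (shift s f x))\<^sup>2) summable_on carrier G"
    using summable_on_reindex_bij_betw[OF bij_right_mult[OF s], of "\<lambda>y. (cmod (f y))\<^sup>2"] f
    by (simp add: l2_def summable_on_cong[OF shifted])
  then show "shift s f \<in> l2G" by (simp add: l2_def shift_def)
  show "normG (shift s f) = normG f"
    using infsum_reindex_bij_betw[OF bij_right_mult[OF s], of "\<lambda>y. (cmod (f y))\<^sup>2"]
    by (simp add: l2_norm_def infsum_cong[OF shifted])
qed

lemma l2_linear_shift: "s \<in> carrier G \<Longrightarrow> l2_linear (carrier G) (shift s)"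
  by standard (simp_all add: shift_l2, simp_all add: shift_def fun_eq_iff)

lemma shift_adjoint:
  assumes s: "s \<in> carrier G"
  shows "innerG (shift s f) g = innerG f (shift (inv s) g)"
proof -
  have "innerG (shift s f) g
      = (\<Sum>\<^sub>\<infinity>x\<in>carrier G. (\<lambda>y. f y * cnj (shift (inv s) g y)) (x \<otimes> s))"
    unfolding l2_inner_def using s by (intro infsum_cong) (simp add: shift_def m_assoc)
  then show ?thesis
    unfolding l2_inner_def
    using infsum_reindex_bij_betw[OF bij_right_mult[OF s], of "\<lambda>y. f y * cnj (shift (inv s) g y)"]
    by simp
qed

lemma right_convolution_uniform:
  "right_convolution G (uniform_weight S) f = (\<lambda>x. 1 / of_nat (card S) * (\<Sum>s\<in>S. shift s f x))"
proof
  fix x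
  show "right_convolution G (uniform_weight S) f x = 1 / of_nat (card S) * (\<Sum>s\<in>S. shift s f x)"
  proof (cases "x \<in> carrier G")
    case True
    have weight: "uniform_weight S \<gamma> = (if \<gamma> \<in> S then 1 / real (card S) else 0)" for \<gamma>
      using finite_S by (simp add: uniform_weight_def)
    have "(\<Sum>\<^sub>\<infinity>\<gamma>\<in>carrier G. f (x \<otimes> inv \<gamma>) * complex_of_real (uniform_weight S \<gamma>))
        = (\<Sum>\<^sub>\<infinity>\<gamma>\<in>S. f (x \<otimes> inv \<gamma>) * (1 / of_nat (card S)))"
      by (rule infsum_cong_neutral) (use S_carrier in \<open>auto simp: weight\<close>)
    also have "\<dots> = (\<Sum>s\<in>S. f (x \<otimes> inv s) * (1 / of_nat (card S)))"
      by (rule infsum_finite[OF finite_S])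
    also have "\<dots> = (\<Sum>s\<in>S. f (x \<otimes> s) * (1 / of_nat (card S)))"
      by (rule sum.reindex_bij_betw[OF bij_inv_S, of "\<lambda>s. f (x \<otimes> s) * (1 / of_nat (card S))"])
    finally show ?thesis
      using True by (simp add: right_convolution_def shift_def sum_divide_distrib)
  qed (simp add: right_convolution_def shift_def)
qed

lemma lap_eq: "lap f = (\<lambda>x. f x - 1 / of_nat (card S) * (\<Sum>s\<in>S. shift s f x))"
  by (simp add: laplace_operator_def right_convolution_uniform)

lemma l2_linear_lap: "l2_linear (carrier G) lap"
proof
  show "lap f \<in> l2G" if "f \<in> l2G" for f
    unfolding lap_eq using that by (intro l2_diff l2_scale l2_sum shift_l2 S_memD)
  show "lap (\<lambda>x. f x + g x) = (\<lambda>x. lap f x + lap g x)" if "f \<in> l2G" "g \<in> l2G" for f g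
    using that
    by (simp add: lap_eq l2_linear.add[OF l2_linear_shift] S_memD sum.distrib fun_eq_iff
        add_divide_distrib)
  show "lap (\<lambda>x. b * f x) = (\<lambda>x. b * lap f x)" if "f \<in> l2G" for b f
    using that
    by (simp add: lap_eq l2_linear.scale[OF l2_linear_shift] S_memD sum_distrib_left[symmetric]
        fun_eq_iff right_diff_distrib)
qed

lemma lap_inner:
  assumes f: "f \<in> l2G" and g: "g \<in> l2G"
  shows "innerG (lap f) g
     = innerG f g - 1 / of_nat (card S) * (\<Sum>s\<in>S. innerG (shift s f) g)"
proof -
  have shifts: "shift s f \<in> l2G" if "s \<in> S" for s using f that by (intro shift_l2 S_memD)
  have "innerG (lap f) g
      = innerG f g - innerG (\<lambda>x. 1 / of_nat (card S) * (\<Sum>s\<in>S. shift s f x)) g"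
    unfolding lap_eq using shifts by (intro l2_inner_diff_left f g l2_scale l2_sum)
  also have "innerG (\<lambda>x. 1 / of_nat (card S) * (\<Sum>s\<in>S. shift s f x)) g
      = 1 / of_nat (card S) * (\<Sum>s\<in>S. innerG (shift s f) g)"
    unfolding l2_inner_scale_left by (subst l2_inner_sum_left) (simp_all add: shifts g)
  finally show ?thesis .
qed

lemma lap_symmetric:
  assumes f: "f \<in> l2G" and g: "g \<in> l2G"
  shows "innerG (lap f) g = innerG f (lap g)"
proof -
  have "cnj (innerG (shift s g) f) = innerG (shift (inv s) f) g" if "s \<in> S" for s
    using shift_adjoint[OF S_memD[OF that], of g f]
      l2_inner_commute[of "carrier G" "shift (inv s) f" g]
    by simp
  then have "(\<Sum>s\<in>S. cnj (innerG (shift s g) f)) = (\<Sum>s\<in>S. innerG (shift (inv s) f) g)" by simp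
  also have "\<dots> = (\<Sum>s\<in>S. innerG (shift s f) g)"
    by (rule sum.reindex_bij_betw[OF bij_inv_S, of "\<lambda>s. innerG (shift s f) g"])
  finally show ?thesis
    using l2_inner_commute[of "carrier G" f "lap g"] l2_inner_commute[of "carrier G" f g]
    by (simp add: lap_inner f g)
qed

definition dirichlet_energy :: "('a \<Rightarrow> complex) \<Rightarrow> real" where
  "dirichlet_energy f = (\<Sum>s\<in>S. (normG (\<lambda>x. shift s f x - f x))\<^sup>2) / (2 * real (card S))"

lemma dirichlet_energy_nonneg: "0 \<le> dirichlet_energy f"
  unfolding dirichlet_energy_def by (intro divide_nonneg_nonneg sum_nonneg) auto

lemma Re_lap_inner_self:
  assumes f: "f \<in> l2G"
  shows "Re (innerG (lap f) f) = dirichlet_energy f"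
proof -
  have "(normG (\<lambda>x. shift s f x - f x))\<^sup>2 = 2 * (normG f)\<^sup>2 - 2 * Re (innerG (shift s f) f)"
    if "s \<in> S" for s
    using l2_norm_diff_sq[OF shift_l2[OF S_memD[OF that] f] f]
    by (simp add: l2_norm_shift S_memD[OF that] f)
  then have "(\<Sum>s\<in>S. (normG (\<lambda>x. shift s f x - f x))\<^sup>2)
      = 2 * real (card S) * (normG f)\<^sup>2 - 2 * (\<Sum>s\<in>S. Re (innerG (shift s f) f))"
    by (simp add: sum_subtractf sum_distrib_left)
  moreover have "Re (innerG (lap f) f)
      = (normG f)\<^sup>2 - (\<Sum>s\<in>S. Re (innerG (shift s f) f)) / real (card S)"
    by (simp add: lap_inner[OF f f] Re_l2_inner_self[OF f] Re_divide_of_nat)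
  ultimately show ?thesis
    unfolding dirichlet_energy_def using card_S_pos by (simp add: field_simps)
qed

lemma dirichlet_energy_le_norm:
  assumes f: "f \<in> l2G"
  shows "dirichlet_energy f \<le> 2 * (normG f)\<^sup>2"
proof -
  have "(\<Sum>s\<in>S. (normG (\<lambda>x. shift s f x - f x))\<^sup>2) \<le> (\<Sum>s\<in>S. 4 * (normG f)\<^sup>2)"
    using l2_norm_diff_sq_le[OF shift_l2[OF S_memD f] f]
    by (intro sum_mono) (simp add: l2_norm_shift S_memD f)
  then show ?thesis unfolding dirichlet_energy_def using card_S_pos by (simp add: field_simps)
qed

lemma dirichlet_energy_contraction:
  assumes f: "f \<in> l2G" and k: "k \<in> l2G"
    and contraction: "\<And>x y. cmod (k x - k y) \<le> cmod (f x - f y)"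
  shows "dirichlet_energy k \<le> dirichlet_energy f"
  unfolding dirichlet_energy_def
proof (intro divide_right_mono sum_mono power_mono l2_norm_mono)
  fix s assume s: "s \<in> S"
  show "(\<lambda>x. shift s f x - f x) \<in> l2G" using s f by (intro l2_diff shift_l2 S_memD)
  show "cmod (shift s k x - k x) \<le> cmod (shift s f x - f x)" if "x \<in> carrier G" for x
    using contraction that by (simp add: shift_def)
  show "shift s k x - k x = 0" if "x \<notin> carrier G" for x
    using that l2_outside[OF k] by (simp add: shift_def)
qed auto

sublocale lap: l2_positive_operator "carrier G" lap 2
  by (intro l2_positive_operator.intro l2_positive_operator_axioms.intro l2_linear_lap
      lap_symmetric)
     (simp_all add: Re_lap_inner_self dirichlet_energy_nonneg dirichlet_energy_le_norm)

end

subsection \<open>Cheeger and Nash inequalities\<close>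

lemma has_bochner_integral_indicator_interval:
  fixes a b :: real
  shows "has_bochner_integral lborel (indicator {a..<b}) (max 0 (b - a))"
proof -
  have "measure lborel {a..<b} = max 0 (b - a)" "emeasure lborel {a..<b} < \<infinity>"
    by (cases "a \<le> b"; simp)+
  then show ?thesis using has_bochner_integral_real_indicator[of "{a..<b}" lborel] by simp
qed

context symmetric_walk
begin

definition isoperimetric :: "real \<Rightarrow> 'a set \<Rightarrow> bool" where
  "isoperimetric r \<Omega> \<longleftrightarrow> (\<forall>U\<subseteq>\<Omega>. real (card U) \<le> r * real (card (inner_boundary G S U)))"

lemma isoperimetric_below_folner:
  assumes "0 < r" and "finite \<Omega>" and "\<Omega> \<subseteq> carrier G" and "card \<Omega> < folner G S r"
  shows "isoperimetric r \<Omega>"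
  unfolding isoperimetric_def
proof (intro allI impI, rule ccontr)
  fix U assume U: "U \<subseteq> \<Omega>" and violated: "\<not> real (card U) \<le> r * real (card (inner_boundary G S U))"
  have "finite U" "U \<noteq> {}"
    using U assms(2) finite_subset violated by (auto simp: inner_boundary_def)
  then have "0 < card U" by (simp add: card_gt_0_iff)
  with violated \<open>0 < r\<close> have "real (card (inner_boundary G S U)) / real (card U) < 1 / r"
    by (simp add: field_simps)
  then have "folner G S r \<le> card U"
    unfolding folner_def using U assms(3) \<open>finite U\<close> \<open>U \<noteq> {}\<close> by (intro Least_le) blast
  also have "card U \<le> card \<Omega>" using U assms(2) by (rule card_mono[rotated])
  finally show False using assms(4) by simp
qed

lemma card_superlevel_boundary_le:
  fixes w :: "'a \<Rightarrow> real"
  assumes "finite \<Omega>" and "{x. t < w x} \<subseteq> \<Omega>"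
  shows "real (card (inner_boundary G S {x. t < w x}))
    \<le> (\<Sum>x\<in>\<Omega>. \<Sum>s\<in>S. indicator {w (x \<otimes> s)..<w x} t)"
proof -
  let ?B = "inner_boundary G S {x. t < w x}"
  have "?B \<subseteq> \<Omega>" using assms(2) by (auto simp: inner_boundary_def)
  then have "real (card ?B) = (\<Sum>x\<in>\<Omega>. indicator ?B x)"
    using assms(1) by (simp add: indicator_def sum.If_cases Int_absorb1)
  also have "\<dots> \<le> (\<Sum>x\<in>\<Omega>. \<Sum>s\<in>S. indicator {w (x \<otimes> s)..<w x} t)"
  proof (rule sum_mono)
    fix x
    show "indicator ?B x \<le> (\<Sum>s\<in>S. indicator {w (x \<otimes> s)..<w x} t :: real)"
    proof (cases "x \<in> ?B")
      case True
      then obtain s where s: "s \<in> S" "w (x \<otimes> s) \<le> t" "t < w x" by (auto simp: inner_boundary_def)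
      then have "indicator ?B x = (indicator {w (x \<otimes> s)..<w x} t :: real)" using True by simp
      also have "\<dots> \<le> (\<Sum>s\<in>S. indicator {w (x \<otimes> s)..<w x} t)"
        by (rule member_le_sum[OF s(1)]) (simp_all add: finite_S)
      finally show ?thesis .
    qed (simp add: sum_nonneg)
  qed
  finally show ?thesis .
qed

text \<open>Integrating the isoperimetric inequality of the superlevel sets \<open>{w > t}\<close> over \<open>t\<close>.\<close>

lemma coarea_inequality:
  fixes w :: "'a \<Rightarrow> real"
  assumes fin: "finite \<Omega>" and r: "0 \<le> r" and iso: "isoperimetric r \<Omega>"
    and w_nonneg: "\<And>x. 0 \<le> w x" and w_out: "\<And>x. x \<notin> \<Omega> \<Longrightarrow> w x = 0"
  shows "(\<Sum>x\<in>\<Omega>. w x) \<le> r * (\<Sum>x\<in>\<Omega>. \<Sum>s\<in>S. max 0 (w x - w (x \<otimes> s)))"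
proof -
  have level: "(\<Sum>x\<in>\<Omega>. indicator {0..<w x} t)
      \<le> r * (\<Sum>x\<in>\<Omega>. \<Sum>s\<in>S. indicator {w (x \<otimes> s)..<w x} t)" for t
  proof (cases "0 \<le> t")
    case True
    have superlevel: "{x. t < w x} \<subseteq> \<Omega>" using True w_out by force
    have "(\<Sum>x\<in>\<Omega>. indicator {0..<w x} t) = (\<Sum>x\<in>\<Omega>. indicator {x. t < w x} x :: real)"
      using True by (intro sum.cong) (auto simp: indicator_def)
    also have "\<dots> = real (card {x. t < w x})"
      using fin superlevel by (simp add: indicator_def sum.If_cases Int_absorb1)
    also have "\<dots> \<le> r * real (card (inner_boundary G S {x. t < w x}))"
      using iso superlevel by (simp add: isoperimetric_def)
    also have "\<dots> \<le> r * (\<Sum>x\<in>\<Omega>. \<Sum>s\<in>S. indicator {w (x \<otimes> s)..<w x} t)"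
      using r by (intro mult_left_mono card_superlevel_boundary_le fin superlevel)
    finally show ?thesis .
  qed (use r in \<open>simp add: sum_nonneg\<close>)
  have lower: "has_bochner_integral lborel (\<lambda>t. \<Sum>x\<in>\<Omega>. indicator {0..<w x} t)
      (\<Sum>x\<in>\<Omega>. max 0 (w x - 0))"
    by (intro has_bochner_integral_sum has_bochner_integral_indicator_interval)
  have upper: "has_bochner_integral lborel
      (\<lambda>t. r * (\<Sum>x\<in>\<Omega>. \<Sum>s\<in>S. indicator {w (x \<otimes> s)..<w x} t))
      (r * (\<Sum>x\<in>\<Omega>. \<Sum>s\<in>S. max 0 (w x - w (x \<otimes> s))))"
    by (intro has_bochner_integral_mult_right has_bochner_integral_sum
        has_bochner_integral_indicator_interval)
  show ?thesis
    using integral_mono[OF integrable.intros[OF lower] integrable.intros[OF upper] level]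
    unfolding has_bochner_integral_integral_eq[OF lower] has_bochner_integral_integral_eq[OF upper]
    by (simp add: w_nonneg)
qed

lemma sum_square_decrease_le:
  fixes h :: "'a \<Rightarrow> real"
  defines "f \<equiv> \<lambda>x. complex_of_real (h x)"
  assumes f: "f \<in> l2G" and s: "s \<in> S" and fin: "finite \<Omega>" and \<Omega>: "\<Omega> \<subseteq> carrier G"
  shows "(\<Sum>x\<in>\<Omega>. max 0 ((h x)\<^sup>2 - (h (x \<otimes> s))\<^sup>2)) \<le> 2 * normG f * normG (\<lambda>x. shift s f x - f x)"
proof -
  have sf: "shift s f \<in> l2G" using s f by (intro shift_l2 S_memD)
  have "max 0 ((h x)\<^sup>2 - (h (x \<otimes> s))\<^sup>2) \<le> \<bar>cmod (shift s f x - f x)\<bar> * \<bar>cmod (shift s f x + f x)\<bar>"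
    if "x \<in> \<Omega>" for x
  proof -
    have "cmod (shift s f x - f x) = \<bar>h (x \<otimes> s) - h x\<bar>"
      "cmod (shift s f x + f x) = \<bar>h (x \<otimes> s) + h x\<bar>"
      using that \<Omega> unfolding f_def shift_def by (auto simp flip: of_real_diff of_real_add)
    moreover have "max 0 ((h x)\<^sup>2 - (h (x \<otimes> s))\<^sup>2) \<le> \<bar>h (x \<otimes> s) - h x\<bar> * \<bar>h (x \<otimes> s) + h x\<bar>"
      unfolding abs_mult[symmetric] by (simp add: power2_eq_square algebra_simps)
    ultimately show ?thesis by simp
  qed
  then have "(\<Sum>x\<in>\<Omega>. max 0 ((h x)\<^sup>2 - (h (x \<otimes> s))\<^sup>2))
      \<le> (\<Sum>x\<in>\<Omega>. \<bar>cmod (shift s f x - f x)\<bar> * \<bar>cmod (shift s f x + f x)\<bar>)"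
    by (rule sum_mono)
  also have "\<dots> \<le> L2_set (\<lambda>x. cmod (shift s f x - f x)) \<Omega>
      * L2_set (\<lambda>x. cmod (shift s f x + f x)) \<Omega>"
    by (rule L2_set_mult_ineq)
  also have "\<dots> \<le> normG (\<lambda>x. shift s f x - f x) * normG (\<lambda>x. shift s f x + f x)"
    by (intro mult_mono L2_set_le_l2_norm l2_diff l2_add sf f fin \<Omega>) auto
  also have "\<dots> \<le> normG (\<lambda>x. shift s f x - f x) * (2 * normG f)"
    using l2_norm_triangle[OF sf f]
    by (intro mult_left_mono) (simp_all add: l2_norm_shift S_memD s f)
  finally show ?thesis by (simp add: mult_ac)
qed

lemma l2_norm_le_sum_gradients:
  fixes h :: "'a \<Rightarrow> real"
  defines "f \<equiv> \<lambda>x. complex_of_real (h x)"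
  assumes fin: "finite \<Omega>" and \<Omega>: "\<Omega> \<subseteq> carrier G" and r: "0 \<le> r" and iso: "isoperimetric r \<Omega>"
    and h_out: "\<And>x. x \<notin> \<Omega> \<Longrightarrow> h x = 0"
  shows "normG f \<le> 2 * r * (\<Sum>s\<in>S. normG (\<lambda>x. shift s f x - f x))" (is "_ \<le> 2 * r * ?D")
proof -
  have f: "f \<in> l2G" by (rule l2_finite_support[OF fin \<Omega>]) (simp add: f_def h_out)
  have "(normG f)\<^sup>2 = (\<Sum>x\<in>\<Omega>. (h x)\<^sup>2)"
    by (subst l2_norm_finite_support[OF fin \<Omega>]) (simp_all add: f_def h_out L2_set_def sum_nonneg)
  also have "\<dots> \<le> r * (\<Sum>x\<in>\<Omega>. \<Sum>s\<in>S. max 0 ((h x)\<^sup>2 - (h (x \<otimes> s))\<^sup>2))"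
    by (rule coarea_inequality[OF fin r iso]) (simp_all add: h_out)
  also have "\<dots> = r * (\<Sum>s\<in>S. \<Sum>x\<in>\<Omega>. max 0 ((h x)\<^sup>2 - (h (x \<otimes> s))\<^sup>2))"
    by (subst sum.swap) simp
  also have "\<dots> \<le> r * (\<Sum>s\<in>S. 2 * normG f * normG (\<lambda>x. shift s f x - f x))"
    unfolding f_def using f r
    by (intro mult_left_mono sum_mono sum_square_decrease_le fin \<Omega>) (simp_all add: f_def)
  also have "\<dots> = normG f * (2 * r * ?D)"
    by (simp add: sum_distrib_left[symmetric])
  finally have "normG f * normG f \<le> normG f * (2 * r * ?D)"
    by (simp add: power2_eq_square)
  then have "normG f = 0 \<or> normG f \<le> 2 * r * ?D"
    by (auto simp: mult_le_cancel_left less_le)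
  moreover have "0 \<le> 2 * r * ?D" using r by (simp add: sum_nonneg)
  ultimately show ?thesis by linarith
qed

lemma cheeger_inequality:
  fixes h :: "'a \<Rightarrow> real"
  defines "f \<equiv> \<lambda>x. complex_of_real (h x)"
  assumes "finite \<Omega>" and "\<Omega> \<subseteq> carrier G" and "0 \<le> r" and "isoperimetric r \<Omega>"
    and "\<And>x. x \<notin> \<Omega> \<Longrightarrow> h x = 0"
  shows "(normG f)\<^sup>2 \<le> 8 * r\<^sup>2 * (real (card S))\<^sup>2 * dirichlet_energy f"
proof -
  define d where "d s = normG (\<lambda>x. shift s f x - f x)" for s
  have "normG f \<le> 2 * r * (\<Sum>s\<in>S. d s)"
    unfolding d_def f_def by (rule l2_norm_le_sum_gradients) fact+
  then have "(normG f)\<^sup>2 \<le> (2 * r * (\<Sum>s\<in>S. d s))\<^sup>2" by (rule power_mono) simp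
  also have "\<dots> = 4 * r\<^sup>2 * (\<Sum>s\<in>S. d s)\<^sup>2" by (simp add: power_mult_distrib)
  also have "\<dots> \<le> 4 * r\<^sup>2 * ((\<Sum>s\<in>S. (d s)\<^sup>2) * real (card S))"
    by (intro mult_left_mono sum_squared_le_sum_of_squares) simp
  also have "(\<Sum>s\<in>S. (d s)\<^sup>2) = 2 * real (card S) * dirichlet_energy f"
    using card_S_pos by (simp add: dirichlet_energy_def d_def)
  finally show ?thesis by (simp add: power2_eq_square mult_ac)
qed

lemma nash_inequality:
  assumes f: "f \<in> l2G" "f \<in> l1_ball (carrier G) m" and m: "0 < m" and r: "0 < r"
    and large: "4 * m\<^sup>2 < real (folner G S r) * (normG f)\<^sup>2"
  shows "(normG f)\<^sup>2 \<le> 16 * r\<^sup>2 * (real (card S))\<^sup>2 * dirichlet_energy f"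
proof -
  define a where "a = (normG f)\<^sup>2 / (4 * m)"
  define \<Omega> where "\<Omega> = {x\<in>carrier G. a < cmod (f x)}"
  let ?k = "soft_threshold a f"
  have norm_pos: "0 < (normG f)\<^sup>2" using large by (cases "normG f = 0") auto
  then have a: "0 < a" using m by (simp add: a_def)
  have fin: "finite \<Omega>" unfolding \<Omega>_def by (rule finite_superlevel[OF f(2) a])
  have \<Omega>: "\<Omega> \<subseteq> carrier G" by (auto simp: \<Omega>_def)
  have "real (card \<Omega>) \<le> m / a" unfolding \<Omega>_def by (rule card_superlevel_le[OF f(2) a])
  also have "\<dots> < real (folner G S r)"
    using large norm_pos m by (simp add: a_def field_simps power2_eq_square)
  finally have iso: "isoperimetric r \<Omega>"
    by (intro isoperimetric_below_folner r fin \<Omega>) simp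
  have "(normG f)\<^sup>2 \<le> (normG ?k)\<^sup>2 + 2 * a * m"
    using a by (intro l2_norm_le_soft_threshold f) simp
  then have "(normG f)\<^sup>2 \<le> 2 * (normG ?k)\<^sup>2" using m by (simp add: a_def field_simps)
  also have "(normG ?k)\<^sup>2 \<le> 8 * r\<^sup>2 * (real (card S))\<^sup>2 * dirichlet_energy ?k"
    unfolding soft_threshold_def using r a l2_outside[OF f(1)]
    by (intro cheeger_inequality[OF fin \<Omega> _ iso]) (auto simp: \<Omega>_def not_less)
  also have "dirichlet_energy ?k \<le> dirichlet_energy f"
    using a
    by (intro dirichlet_energy_contraction soft_threshold_l2 f soft_threshold_contraction) simp
  finally show ?thesis by (simp add: mult_left_mono)
qed

subsection \<open>Decay of the lazy random walk\<close>

lemma shift_l1_ball: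
  assumes s: "s \<in> carrier G" and f: "f \<in> l1_ball (carrier G) m"
  shows "shift s f \<in> l1_ball (carrier G) m"
  unfolding l1_ball_def
proof (intro CollectI allI impI)
  fix A assume A: "finite A" "A \<subseteq> carrier G"
  have "inj_on (\<lambda>x. x \<otimes> s) A"
    using bij_right_mult[OF s] A(2) by (auto simp: bij_betw_def intro: inj_on_subset)
  then have "(\<Sum>x\<in>A. cmod (shift s f x)) = (\<Sum>y\<in>(\<lambda>x. x \<otimes> s) ` A. cmod (f y))"
    using A by (auto simp: sum.reindex shift_def intro!: sum.cong)
  also have "\<dots> \<le> m" using A s by (intro l1_ballD[OF f]) auto
  finally show "(\<Sum>x\<in>A. cmod (shift s f x)) \<le> m" .
qed

definition lazy_step :: "real poly" where
  "lazy_step = [:1, -1/2:]"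

lemma op_poly_lazy_step:
  assumes f: "f \<in> l2G"
  shows "lap.op_poly lazy_step f
           = (\<lambda>x. 1/2 * f x + 1 / of_nat (2 * card S) * (\<Sum>s\<in>S. shift s f x))"
proof
  fix x
  have "lap.op_poly lazy_step f x = f x + lap (\<lambda>x. complex_of_real (-1/2) * f x) x"
    by (simp only: lazy_step_def lap.op_poly_pCons lap.op_poly_0 lap.zero of_real_1 mult_1_left
        add_0_right)
  also have "\<dots> = f x - 1/2 * lap f x" by (simp only: lap.scale[OF f]) simp
  finally show "lap.op_poly lazy_step f x
      = 1/2 * f x + 1 / of_nat (2 * card S) * (\<Sum>s\<in>S. shift s f x)"
    by (simp add: lap_eq algebra_simps)
qed

lemma lazy_step_l1_ball:
  assumes "f \<in> l2G" and f: "f \<in> l1_ball (carrier G) m"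
  shows "lap.op_poly lazy_step f \<in> l1_ball (carrier G) m"
  unfolding l1_ball_def
proof (intro CollectI allI impI)
  fix A assume A: "finite A" "A \<subseteq> carrier G"
  let ?b = "1 / (2 * real (card S))"
  have "cmod (lap.op_poly lazy_step f x)
      \<le> 1/2 * cmod (f x) + ?b * (\<Sum>s\<in>S. cmod (shift s f x))" for x
  proof -
    have "cmod (lap.op_poly lazy_step f x)
        \<le> cmod (1/2 * f x) + cmod (1 / of_nat (2 * card S) * (\<Sum>s\<in>S. shift s f x))"
      unfolding op_poly_lazy_step[OF assms(1)] by (rule norm_triangle_ineq)
    also have "\<dots> = 1/2 * cmod (f x) + ?b * cmod (\<Sum>s\<in>S. shift s f x)"
      by (simp add: norm_mult norm_divide)
    also have "\<dots> \<le> 1/2 * cmod (f x) + ?b * (\<Sum>s\<in>S. cmod (shift s f x))"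
      by (intro add_left_mono mult_left_mono norm_sum) simp
    finally show ?thesis .
  qed
  then have "(\<Sum>x\<in>A. cmod (lap.op_poly lazy_step f x))
      \<le> (\<Sum>x\<in>A. 1/2 * cmod (f x) + ?b * (\<Sum>s\<in>S. cmod (shift s f x)))"
    by (rule sum_mono)
  also have "\<dots> = 1/2 * (\<Sum>x\<in>A. cmod (f x)) + ?b * (\<Sum>s\<in>S. \<Sum>x\<in>A. cmod (shift s f x))"
    by (simp only: sum.distrib sum_distrib_left[symmetric] sum.swap[of _ S A])
  also have "\<dots> \<le> 1/2 * m + ?b * (\<Sum>s\<in>S. m)"
    using l1_ballD[OF f A] l1_ballD[OF shift_l1_ball[OF S_memD f] A]
    by (intro add_mono mult_left_mono sum_mono) auto
  also have "\<dots> = m" using card_S_pos by simp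
  finally show "(\<Sum>x\<in>A. cmod (lap.op_poly lazy_step f x)) \<le> m" .
qed

lemma lazy_step_energy:
  assumes f: "f \<in> l2G"
  shows "(normG (lap.op_poly lazy_step f))\<^sup>2 \<le> (normG f)\<^sup>2 - dirichlet_energy f / 2"
proof -
  interpret form: real_poly_functional "lap.op_poly_form f"
    by (rule lap.real_poly_functional_op_poly_form[OF f])
  have energy: "lap.op_poly_form f [:0, 1:] = dirichlet_energy f"
    using f by (simp add: lap.op_poly_form_def lap.op_poly_pCons Re_lap_inner_self)
  have "lazy_step\<^sup>2 = 1 - smult (1/2) [:0, 1:] - smult (1/4) ([:0, 1:] * [:2, -1:])"
    by (simp add: lazy_step_def power2_eq_square one_pCons)
  then have "lap.op_poly_form f (lazy_step\<^sup>2)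
      = (normG f)\<^sup>2 - 1/2 * dirichlet_energy f - 1/4 * lap.op_poly_form f ([:0, 1:] * [:2, -1:])"
    by (simp only: form.diff form.smult lap.op_poly_form_1[OF f] energy)
  with lap.op_poly_form_product_nonneg[OF f] show ?thesis
    by (simp add: lap.op_poly_form_square[OF f])
qed

definition lazy_walk :: "nat \<Rightarrow> 'a \<Rightarrow> complex" where
  "lazy_walk n = lap.op_poly (lazy_step ^ n) (l2_delta \<one>)"

lemma lazy_walk_Suc: "lazy_walk (Suc n) = lap.op_poly lazy_step (lazy_walk n)"
  by (simp add: lazy_walk_def lap.op_poly_mult)

lemma lazy_walk_l2: "lazy_walk n \<in> l2G"
  by (simp add: lazy_walk_def)

lemma lazy_walk_l1_ball: "lazy_walk n \<in> l1_ball (carrier G) 1"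
proof (induction n)
  case 0
  have "(\<Sum>x\<in>A. cmod (l2_delta \<one> x)) \<le> 1" if "finite A" for A
    using that by (simp add: l2_delta_def if_distrib[of cmod] cong: if_cong)
  then show ?case by (simp add: lazy_walk_def l1_ball_def)
qed (simp add: lazy_walk_Suc lazy_step_l1_ball lazy_walk_l2)

text \<open>By self-adjointness this is the return probability of the lazy walk after \<open>2 n\<close> steps.\<close>

definition return_prob :: "nat \<Rightarrow> real" where
  "return_prob n = (normG (lazy_walk n))\<^sup>2"

lemma return_prob_nonneg: "0 \<le> return_prob n"
  by (simp add: return_prob_def)

lemma return_prob_Suc_le:
  "return_prob (Suc n) \<le> return_prob n - dirichlet_energy (lazy_walk n) / 2"
  using lazy_step_energy[OF lazy_walk_l2] by (simp add: return_prob_def lazy_walk_Suc)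

definition contraction_rate :: "real \<Rightarrow> real" where
  "contraction_rate r = 1 / (32 * r\<^sup>2 * (real (card S))\<^sup>2)"

lemma return_prob_contraction:
  assumes r: "0 < r" and "4 < real (folner G S r) * return_prob n"
  shows "return_prob (Suc n) \<le> (1 - contraction_rate r) * return_prob n"
proof -
  have "return_prob n \<le> 16 * r\<^sup>2 * (real (card S))\<^sup>2 * dirichlet_energy (lazy_walk n)"
    using nash_inequality[OF lazy_walk_l2 lazy_walk_l1_ball _ r, of n] assms(2)
    by (simp add: return_prob_def)
  then have "contraction_rate r * return_prob n \<le> dirichlet_energy (lazy_walk n) / 2"
    using r card_S_pos by (simp add: contraction_rate_def field_simps)
  with return_prob_Suc_le[of n] show ?thesis by (simp add: algebra_simps)
qed

lemma return_prob_le_max: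
  assumes r: "0 < r" and fol: "0 < folner G S r"
  shows "return_prob n \<le> max (4 / real (folner G S r)) ((1 - contraction_rate r) ^ n)"
proof (induction n)
  case 0
  show ?case by (simp add: return_prob_def lazy_walk_def l2_norm_delta)
next
  case (Suc n)
  show ?case
  proof (cases "return_prob n \<le> 4 / real (folner G S r)")
    case True
    then show ?thesis
      using return_prob_Suc_le[of n] dirichlet_energy_nonneg[of "lazy_walk n"] by simp
  next
    case False
    then have "4 < real (folner G S r) * return_prob n" using fol by (simp add: field_simps)
    note contraction = return_prob_contraction[OF r this]
    have "0 \<le> 4 / real (folner G S r)" by simp
    with False have "0 < return_prob n" by linarith
    moreover have "0 \<le> (1 - contraction_rate r) * return_prob n"
      using contraction return_prob_nonneg[of "Suc n"] by linarith
    ultimately have "0 \<le> 1 - contraction_rate r" by (simp add: zero_le_mult_iff)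
    moreover have "return_prob n \<le> (1 - contraction_rate r) ^ n" using Suc.IH False by simp
    ultimately have "(1 - contraction_rate r) * return_prob n \<le> (1 - contraction_rate r) ^ Suc n"
      by (simp add: mult_left_mono)
    with contraction show ?thesis by simp
  qed
qed

lemma spectral_distribution_eq:
  "spectral_distribution G (uniform_weight S) a
     = measure (l2_spectral_measure (carrier G) lap (l2_delta \<one>)) {..a}"
  by (simp add: spectral_distribution_def lap.spectral_projection_inner)

lemma spectral_distribution_nonneg: "0 \<le> spectral_distribution G (uniform_weight S) a"
  by (simp add: spectral_distribution_eq)

lemma mono_spectral_distribution: "mono (spectral_distribution G (uniform_weight S))"
proof -
  interpret bounded_borel_measure "l2_spectral_measure (carrier G) lap (l2_delta \<one>)" 2
    by (rule lap.bounded_borel_measure_spectral) simp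
  show ?thesis by (auto simp: mono_def spectral_distribution_eq intro!: finite_measure_mono)
qed

lemma spectral_distribution_le_return_prob:
  assumes a: "a \<le> 2"
  shows "(1 - a / 2) ^ (2 * n) * spectral_distribution G (uniform_weight S) a \<le> return_prob n"
proof -
  interpret bounded_borel_measure "l2_spectral_measure (carrier G) lap (l2_delta \<one>)" 2
    by (rule lap.bounded_borel_measure_spectral) simp
  have "(1 - a / 2) ^ (2 * n) \<le> (poly (lazy_step ^ n) x)\<^sup>2" if "x \<le> a" for x
  proof -
    have "(1 - a / 2) ^ (2 * n) \<le> (1 - x / 2) ^ (2 * n)" using that a by (intro power_mono) auto
    then show ?thesis by (simp add: lazy_step_def power_mult[symmetric] mult.commute[of n])
  qed
  then have "(1 - a / 2) ^ (2 * n) * spectral_distribution G (uniform_weight S) a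
      \<le> (\<integral>x. (poly (lazy_step ^ n) x)\<^sup>2 \<partial>l2_spectral_measure (carrier G) lap (l2_delta \<one>))"
    unfolding spectral_distribution_eq
    by (intro measure_atMost_le_integral_poly_square) (simp_all add: power_mult)
  also have "\<dots> = return_prob n"
    by (simp add: return_prob_def lazy_walk_def lap.l2_norm_op_poly)
  finally show ?thesis .
qed

end

lemma exp_minus_le_one_minus_half:
  fixes x :: real
  assumes "0 \<le> x" and "x \<le> 1"
  shows "exp (- x) \<le> 1 - x / 2"
proof -
  have "1 \<le> (1 - x / 2) * (1 + x)"
    using assms mult_left_le[of x x] by (simp add: algebra_simps)
  also have "\<dots> \<le> (1 - x / 2) * exp x"
    using assms exp_ge_add_one_self[of x] by (intro mult_left_mono) auto
  finally show ?thesis by (simp add: exp_minus field_simps)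
qed

text \<open>The number \<open>n\<close> of steps is minimal with \<open>exp (- 4 a n) \<le> v\<close>.\<close>

lemma geometric_decay_time:
  fixes a v :: real
  assumes a: "0 < a" "a \<le> 1 / 4" and v: "0 < v" "v \<le> 1"
  shows "\<exists>n. (1 - 4 * a) ^ n \<le> v \<and> exp (- 2) * sqrt v \<le> (1 - a / 2) ^ (2 * n)"
proof -
  define n where "n = nat \<lceil>- ln v / (4 * a)\<rceil>"
  have "0 \<le> - ln v / (4 * a)" using a v by (simp add: divide_le_0_iff)
  then have n: "- ln v / (4 * a) \<le> real n" "real n \<le> - ln v / (4 * a) + 1"
    unfolding n_def using of_int_ceiling_le_add_one[of "- ln v / (4 * a)"]
    by (simp_all add: real_nat_ceiling_ge)
  have "(1 - 4 * a) ^ n \<le> exp (- (4 * a)) ^ n"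
    using a exp_ge_add_one_self[of "- (4 * a)"] by (intro power_mono) auto
  also have "\<dots> = exp (- (4 * a * real n))" by (simp add: exp_of_nat_mult[symmetric] mult.commute)
  also have "\<dots> \<le> exp (ln v)" using n(1) a by (simp add: field_simps)
  finally have "(1 - 4 * a) ^ n \<le> v" using v by simp
  moreover have "exp (- 2) * sqrt v \<le> (1 - a / 2) ^ (2 * n)"
  proof -
    have "exp (- 2) * sqrt v = exp (- 2 + ln v / 2)"
      using v by (simp only: exp_add) (simp add: powr_def powr_half_sqrt[symmetric])
    also have "\<dots> \<le> exp (- (2 * a * real n))" using n(2) a by (simp add: field_simps)
    also have "\<dots> = exp (- a) ^ (2 * n)"
      by (simp add: exp_of_nat_mult[symmetric] algebra_simps)
    also have "\<dots> \<le> (1 - a / 2) ^ (2 * n)"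
      using a by (intro power_mono exp_minus_le_one_minus_half) auto
    finally show ?thesis .
  qed
  ultimately show ?thesis by blast
qed

lemma (in symmetric_walk) spectral_distribution_le_folner:
  assumes r: "0 < r" and rate: "contraction_rate r = 4 * a" and a: "0 < a" "a \<le> 1 / 4"
    and fol: "4 \<le> folner G S r"
  shows "spectral_distribution G (uniform_weight S) a \<le> 2 * exp 2 / sqrt (real (folner G S r))"
proof -
  let ?N = "spectral_distribution G (uniform_weight S) a"
  define v where "v = 4 / real (folner G S r)"
  have v: "0 < v" "v \<le> 1" using fol by (simp_all add: v_def)
  obtain n where n: "(1 - 4 * a) ^ n \<le> v" "exp (- 2) * sqrt v \<le> (1 - a / 2) ^ (2 * n)"
    using geometric_decay_time[OF a v] by blast
  have "exp (- 2) * sqrt v * ?N \<le> (1 - a / 2) ^ (2 * n) * ?N"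
    by (rule mult_right_mono[OF n(2) spectral_distribution_nonneg])
  also have "\<dots> \<le> return_prob n"
    using a by (intro spectral_distribution_le_return_prob) simp
  also have "\<dots> \<le> v"
    using return_prob_le_max[OF r, of n] fol n(1) by (simp add: rate v_def)
  also have "v = sqrt v * sqrt v" using v by simp
  finally have "sqrt v * (exp (- 2) * ?N) \<le> sqrt v * sqrt v" by (simp only: mult_ac)
  then have "exp (- 2) * ?N \<le> sqrt v" using v by (subst (asm) mult_le_cancel_left_pos) auto
  then have "?N \<le> exp 2 * sqrt v" by (simp add: exp_minus field_simps)
  then show ?thesis by (simp add: v_def real_sqrt_divide mult.commute)
qed

subsection \<open>Comparison of growth functions\<close>

lemma eventually_square_le_dilate:
  fixes F g :: "real \<Rightarrow> real"
  assumes lim: "filterlim F at_top at_top"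
    and square: "\<exists>C>1. \<forall>\<^sub>F r in at_top. (F r)\<^sup>2 \<le> F (C * r)"
    and prec: "preceq_at_infinity F g"
  shows "\<exists>d>0. \<forall>\<^sub>F r in at_top. K * (F r)\<^sup>2 \<le> g (d * r)"
proof -
  obtain B d x where B: "0 < B" and d: "0 < d" and F_le: "\<And>r. x \<le> r \<Longrightarrow> F r \<le> B * g (d * r)"
    using prec unfolding preceq_at_infinity_def by blast
  obtain C where C: "1 < C" and square_le: "\<forall>\<^sub>F r in at_top. (F r)\<^sup>2 \<le> F (C * r)"
    using square by blast
  have dilate: "filterlim (\<lambda>r. b * r) at_top at_top" if "0 < b" for b :: real
    using that
    by (intro filterlim_tendsto_pos_mult_at_top[OF tendsto_const]) (auto simp: filterlim_ident)
  have "\<forall>\<^sub>F r in at_top. max 1 (B * K) \<le> F r"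
    using lim unfolding filterlim_at_top by blast
  moreover note square_le
  moreover have "\<forall>\<^sub>F r in at_top. (F (C * r))\<^sup>2 \<le> F (C * (C * r))"
    using eventually_compose_filterlim[OF square_le dilate] C by simp
  moreover have "\<forall>\<^sub>F r in at_top. x \<le> C * C * r"
    using eventually_compose_filterlim[OF eventually_ge_at_top dilate] C by simp
  ultimately have "\<forall>\<^sub>F r in at_top. K * (F r)\<^sup>2 \<le> g (d * C * C * r)"
  proof eventually_elim
    case (elim r)
    have "B * K \<le> (F r)\<^sup>2" using elim(1) self_le_power[of "F r" 2] by simp
    then have "B * K * (F r)\<^sup>2 \<le> (F r)\<^sup>2 * (F r)\<^sup>2" by (rule mult_right_mono) simp
    also have "\<dots> = ((F r)\<^sup>2)\<^sup>2" by (simp add: power2_eq_square)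
    also have "\<dots> \<le> (F (C * r))\<^sup>2" using elim(2) by (rule power_mono) simp
    also have "\<dots> \<le> F (C * (C * r))" by (rule elim(3))
    also have "\<dots> \<le> B * g (d * (C * (C * r)))" using elim(4) by (intro F_le) (simp add: mult.assoc)
    finally show ?case using B by (simp add: mult_ac)
  qed
  with C d show ?thesis by (intro exI[of _ "d * C * C"]) simp
qed

lemma dil_preceq_at_zeroI:
  fixes N F :: "real \<Rightarrow> real"
  assumes N: "mono N" and F: "filterlim F at_top at_top" and D: "0 < D"
    and le: "\<forall>\<^sub>F z in at_top. N (1 / (D * z\<^sup>2)) \<le> 1 / F z"
  shows "dil_preceq_at_zero N (\<lambda>a. if a = 0 then 0 else 1 / F (a powr (-1/2)))"
proof -
  obtain Z where Z: "0 < Z" and N_le: "\<And>z. Z \<le> z \<Longrightarrow> N (1 / (D * z\<^sup>2)) \<le> 1 / F z"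
    using eventually_conj[OF le eventually_gt_at_top[of 0]]
    unfolding eventually_at_top_linorder by blast
  have "N 0 \<le> 0"
  proof (rule tendsto_lowerbound)
    show "((\<lambda>z. 1 / F z) \<longlongrightarrow> 0) at_top"
      by (rule tendsto_divide_0[OF tendsto_const filterlim_at_top_imp_at_infinity[OF F]])
    show "\<forall>\<^sub>F z in at_top. N 0 \<le> 1 / F z"
      using le
    proof eventually_elim
      case (elim z)
      have "N 0 \<le> N (1 / (D * z\<^sup>2))" using D by (intro monoD[OF N]) simp
      with elim show ?case by (rule order_trans[rotated])
    qed
  qed simp
  moreover have "N a \<le> 1 / F ((D * a) powr (-1/2))" if a: "0 < a" "a < 1 / (D * Z\<^sup>2)" for a
  proof -
    have "Z\<^sup>2 * (D * a) \<le> 1" using a D Z by (simp add: field_simps)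
    then have "Z * sqrt (D * a) \<le> 1"
      using Z real_sqrt_le_mono[of "Z\<^sup>2 * (D * a)" 1] by (simp add: real_sqrt_mult)
    moreover have root: "(D * a) powr (-1/2) = 1 / sqrt (D * a)"
      using a D by (simp add: powr_minus powr_half_sqrt field_simps)
    ultimately have "Z \<le> (D * a) powr (-1/2)" unfolding root using a D by (simp add: field_simps)
    moreover have "1 / (D * ((D * a) powr (-1/2))\<^sup>2) = a"
      unfolding root using a D by (simp add: power_divide)
    ultimately show ?thesis using N_le by metis
  qed
  ultimately show ?thesis
    unfolding dil_preceq_at_zero_def using D Z
    by (intro exI[of _ D] conjI exI[of _ "1 / (D * Z\<^sup>2)"]) auto
qed

lemma (in symmetric_walk) eventually_spectral_distribution_le:
  assumes F: "filterlim F at_top at_top" and d: "0 < d"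
    and fol: "\<forall>\<^sub>F r in at_top. 4 * exp 4 * (F r)\<^sup>2 \<le> real (folner G S (d * r))"
  shows "\<forall>\<^sub>F z in at_top. spectral_distribution G (uniform_weight S)
           (1 / (128 * d\<^sup>2 * (real (card S))\<^sup>2 * z\<^sup>2)) \<le> 1 / F z"
proof -
  have "\<forall>\<^sub>F z in at_top. 1 \<le> F z" using F by (simp add: filterlim_at_top)
  then show ?thesis
    using fol eventually_ge_at_top[of "1 / d"]
  proof eventually_elim
    case (elim z)
    define \<phi> where "\<phi> = real (folner G S (d * z))"
    define a where "a = 1 / (128 * d\<^sup>2 * (real (card S))\<^sup>2 * z\<^sup>2)"
    have dz: "1 \<le> d * z" using elim(3) d by (simp add: field_simps)
    have "0 < z" using elim(3) d by (simp add: less_le_trans[of 0 "1 / d"])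
    have "1 \<le> (d * z)\<^sup>2 * (real (card S))\<^sup>2"
      using card_S_pos by (intro mult_ge1_I[OF one_le_power[OF dz] one_le_power]) simp
    then have a: "0 < a" "a \<le> 1 / 4"
      using d \<open>0 < z\<close> card_S_pos by (simp_all add: a_def power_mult_distrib field_simps)
    have rate: "contraction_rate (d * z) = 4 * a"
      by (simp add: contraction_rate_def a_def power_mult_distrib)
    have "4 \<le> 4 * exp 4 * (F z)\<^sup>2"
      using mult_mono[of 1 "exp 4" 1 "(F z)\<^sup>2"] one_le_power[OF elim(1), of 2] by simp
    with elim(2) have fol4: "4 \<le> folner G S (d * z)" by linarith
    have "2 * exp 2 * F z = sqrt (4 * exp 4 * (F z)\<^sup>2)"
      using elim(1) exp_double[of "2 :: real"] by (simp add: real_sqrt_mult)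
    also have "\<dots> \<le> sqrt \<phi>" unfolding \<phi>_def by (rule real_sqrt_le_mono[OF elim(2)])
    finally have "2 * exp 2 / sqrt \<phi> \<le> 1 / F z" using elim(1) fol4 by (simp add: \<phi>_def field_simps)
    with spectral_distribution_le_folner[OF _ rate a fol4] dz show ?case
      unfolding a_def[symmetric] \<phi>_def by linarith
  qed
qed

theorem proposition1p6:
  fixes G :: "('a, 'b) monoid_scheme" and S :: "'a set"
    and F :: "real \<Rightarrow> real" and x\<^sub>0 :: real
  assumes "group G" and "infinite (carrier G)" and "amenable G"
    and "finite S" and "S \<subseteq> carrier G"
    and "\<forall>s\<in>S. inv\<^bsub>G\<^esub> s \<in> S" and "generate G S = carrier G"
    and "\<forall>r>x\<^sub>0. F r > 0"
    and "continuous_on {x\<^sub>0<..} F" and "strict_mono_on {x\<^sub>0<..} F"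
    and "filterlim F at_top at_top"
    and "\<exists>C>1. \<forall>\<^sub>F r in at_top. (F r)\<^sup>2 \<le> F (C * r)"
    and "preceq_at_infinity F (\<lambda>r. real (folner G S r))"
  shows "dil_preceq_at_zero (spectral_distribution G (uniform_weight S))
           (\<lambda>lam. if lam = 0 then 0 else 1 / F (lam powr (-1/2)))"
proof -
  have "S \<noteq> {}"
    using assms(2,7) group.generate_empty[OF assms(1)] by (metis finite.emptyI finite.insertI)
  then interpret symmetric_walk G S
    using assms(1,4-6) by (simp add: symmetric_walk_def symmetric_walk_axioms_def)
  obtain d where d: "0 < d"
    and folner: "\<forall>\<^sub>F r in at_top. 4 * exp 4 * (F r)\<^sup>2 \<le> real (folner G S (d * r))"
    using eventually_square_le_dilate[OF assms(11-13)] by blast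
  have "0 < 128 * d\<^sup>2 * (real (card S))\<^sup>2" using d card_S_pos by simp
  then show ?thesis
    by (rule dil_preceq_at_zeroI[OF mono_spectral_distribution assms(11) _
          eventually_spectral_distribution_le[OF assms(11) d folner]])
qed

end
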